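(* Let $a(R),u(R)$ be ultimately increasing real valued functions defined on $[m_0,\infty)$ with $m_0\in\mathbb{N}$. Assume that the sequences $(\lfloor a(m)\rfloor)_{m=m_0}^{\infty}$ and $(\lfloor u(m)\rfloor)_{m=m_0}^{\infty}$ are also ultimately increasing. Let $b(R),v(R)$ be the inverse functions of $a(R),u(R)$, respectively, for any sufficiently large $R$. Assume that $a(R)$ satisfies the following two assumptions: (a1) $(\log a(R))/(\log R)$ is ultimately increasing and $\lim_{R\to\infty}\frac{\log a(R)}{\log R}=\infty$. (a2) $a(R)$ is differentiable. Moreover, for an arbitrary positive real number $\varepsilon$, there exists a positive constant $C_{10}(\varepsilon)$, depending only on $\varepsilon$, such that $(\log a(R))'<R^{-1+\varepsilon}$ for any real number $R$ with $R\geq C_{10}(\varepsilon)$. Moreover, suppose that $u(R)$ fulfills the following two assumptions: (u1) There exists a positive constant $C_{11}$ such that $\frac{u(R+1)}{u(R)}<C_{11}$ for any sufficiently large real number $R$. (u2) $\lim_{R\to\infty}\frac{\log b(R)}{\log v(R)}=\infty$. Then, for any Pisot or Salem number $\beta$, the two numbers $$\sum_{m=m_0}^{\infty}\beta^{-\lfloor a(m)\rfloor},\qquad \sum_{m=m_0}^{\infty}\beta^{-\lfloor u(m)\rfloor}$$ are algebraically independent.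
   Context: $\mathbb{N}$ is the set of nonnegative integers; $\lfloor x\rfloor$ is the integral part of $x$; algebraic independence is over $\mathbb{Q}$. A real valued function on an interval $[R_0,\infty)$ (resp. a sequence) is called ultimately increasing if it is strictly increasing for all sufficiently large real arguments $R$ (resp. all sufficiently large integer indices $m$). The inverse functions $b(R)$, $v(R)$ are understood to be defined for all sufficiently large real $R$. A Pisot number is an algebraic integer greater than $1$ whose conjugates other than itself all have absolute value less than $1$. A Salem number is an algebraic integer greater than $1$ whose conjugates other than itself all have absolute value at most $1$, with at least one conjugate of absolute value exactly $1$. *)

theory Defs
  imports "HOL-Analysis.Analysis" "HOL-Computational_Algebra.Computational_Algebra"
begin

definition ultimately_increasing :: "('a::linorder \<Rightarrow> 'b::ord) \<Rightarrow> bool" where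
  "ultimately_increasing f \<longleftrightarrow> (\<exists>R1. strict_mono_on {R1..} f)"

text \<open>
  \<open>g\<close> is the inverse, defined for all sufficiently large reals, of the restriction of \<open>f\<close> to a ray
  \<open>{R1..}\<close> inside its domain \<open>{R0..}\<close>.  Continuity of \<open>f\<close> is not assumed, so the image being all of
  \<open>{f R1..}\<close> is part of the claim that the inverse exists.  Values of \<open>g\<close> below \<open>f R1\<close> are arbitrary.
\<close>
definition ultimate_inverse :: "real \<Rightarrow> (real \<Rightarrow> real) \<Rightarrow> (real \<Rightarrow> real) \<Rightarrow> bool" where
  "ultimate_inverse R0 f g \<longleftrightarrow>
     (\<exists>R1\<ge>R0. strict_mono_on {R1..} f \<and> bij_betw f {R1..} {f R1..} \<and>
        (\<forall>x\<ge>f R1. g x = inv_into {R1..} f x))"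

text \<open>
  Conjugates over the rationals: complex numbers with the same minimal polynomial, i.e. roots
  of a common irreducible rational polynomial.
\<close>
definition rat_conjugate :: "complex \<Rightarrow> complex \<Rightarrow> bool" where
  "rat_conjugate x y \<longleftrightarrow>
     (\<exists>p :: rat poly. irreducible p \<and>
        poly (map_poly of_rat p) x = 0 \<and> poly (map_poly of_rat p) y = 0)"

definition Pisot :: "real \<Rightarrow> bool" where
  "Pisot \<beta> \<longleftrightarrow> algebraic_int \<beta> \<and> \<beta> > 1 \<and>
     (\<forall>z. rat_conjugate (of_real \<beta>) z \<and> z \<noteq> of_real \<beta> \<longrightarrow> norm z < 1)"

definition Salem :: "real \<Rightarrow> bool" where
  "Salem \<beta> \<longleftrightarrow> algebraic_int \<beta> \<and> \<beta> > 1 \<and>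
     (\<forall>z. rat_conjugate (of_real \<beta>) z \<and> z \<noteq> of_real \<beta> \<longrightarrow> norm z \<le> 1) \<and>
     (\<exists>z. rat_conjugate (of_real \<beta>) z \<and> z \<noteq> of_real \<beta> \<and> norm z = 1)"

text \<open>
  A polynomial in \<open>\<rat>[X,Y]\<close> is represented as a polynomial in \<open>Y\<close> with coefficients in \<open>\<rat>[X]\<close>.
\<close>
definition eval2 :: "rat poly poly \<Rightarrow> real \<Rightarrow> real \<Rightarrow> real" where
  "eval2 P x y = poly (map_poly (\<lambda>q. poly (map_poly of_rat q) x) P) y"

definition algebraically_independent :: "real \<Rightarrow> real \<Rightarrow> bool" where
  "algebraically_independent x y \<longleftrightarrow> (\<forall>P :: rat poly poly. P \<noteq> 0 \<longrightarrow> eval2 P x y \<noteq> 0)"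

end

theory Submission
  imports Defs "Jordan_Normal_Form.Determinant" "HOL-Real_Asymp.Real_Asymp"
    "Berlekamp_Zassenhaus.Square_Free_Int_To_Square_Free_GFp"
begin

text \<open>
  Put \<open>x = 1/\<beta>\<close>. Up to powers of \<open>\<beta>\<close> the two numbers are \<open>F(x)\<close> and \<open>G(x)\<close> for power series with
  nonnegative integer coefficients, so an algebraic relation yields
  \<open>H = \<Sum> c\<^sub>i\<^sub>j X\<^bsup>e(i,j)\<^esup> F\<^sup>i G\<^sup>j\<close> with polynomially bounded integer coefficients and \<open>H(x) = 0\<close>.
  The arithmetic of \<open>\<beta>\<close> enters only once: since the other conjugates lie in the closed unit disc and
  nonzero elements of \<open>\<int>[\<beta>]\<close> have norm at least 1, the expansion \<open>H(x) = 0\<close> cannot have a positive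
  coefficient at some \<open>z \<le> N\<close> preceded by a zero block and followed by a nonnegative block of length
  \<open>B ln N\<close>.

  Such a \<open>z\<close> is found in the support of the lexicographically leading term \<open>F\<^sup>k G\<^sup>l\<close>. The supports of the
  terms with \<open>i < k\<close> have about \<open>b(N)\<^bsup>k-1\<^esup>\<close> elements below \<open>N\<close>, because \<open>v(N)\<close> is an arbitrarily small
  power of \<open>b(N)\<close>; they leave free an interval of length almost \<open>N/b(N)\<^bsup>k-1\<^esup>\<close>, whereas \<open>k\<close> greedy
  approximations by values of \<open>a\<close> give gaps of only about \<open>N/b(N)\<^sup>k\<close> in the support of \<open>F\<^sup>k\<close>. The terms
  with \<open>i = k\<close>, \<open>j < l\<close> are then avoided by adding an exponent of \<open>G\<close> to the last element before a long
  gap; such exponents exist at every scale as \<open>u\<close> grows at most geometrically.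
\<close>

section \<open>Norms of elements of \<open>\<int>[\<beta>]\<close>\<close>

hide_const (open) up_ring.monom up_ring.coeff

text \<open>Pseudo-division scales \<open>f\<close> by a power of \<open>lead_coeff p\<close>. This
  power is 1 here, so it is genuine division over the integers.\<close>

lemma monic_int_poly_division:
  fixes p f :: "int poly"
  assumes "lead_coeff p = 1" "degree p > 0"
  obtains q r where "f = p * q + r" "degree r < degree p"
proof -
  obtain q r where qr: "pseudo_divmod f p = (q, r)" by force
  have p0: "p \<noteq> 0" using assms by auto
  show ?thesis
    using pseudo_divmod[OF p0 qr] assms by (intro that[of q r]) auto
qed

text \<open>A nonzero kernel vector of the transposed matrix is the coefficient vector of a nonzero
  polynomial with \<open>d\<close> distinct roots and degree below \<open>d\<close>.\<close>

lemma vandermonde_det_nonzero: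
  fixes zs :: "'a :: field list"
  assumes "distinct zs" "length zs = d"
  shows "det (mat d d (\<lambda>(i,j). (zs ! j) ^ i)) \<noteq> 0"
proof
  let ?V = "mat d d (\<lambda>(i,j). (zs ! j) ^ i)"
  assume "det ?V = 0"
  then have "det (transpose_mat ?V) = 0" by (subst det_transpose[of _ d]) auto
  moreover have "transpose_mat ?V \<in> carrier_mat d d" by auto
  ultimately obtain c where c: "c \<in> carrier_vec d" "c \<noteq> 0\<^sub>v d" "transpose_mat ?V *\<^sub>v c = 0\<^sub>v d"
    using det_0_iff_vec_prod_zero by metis
  define q where "q = (\<Sum>i<d. monom (vec_index c i) i)"
  have root: "poly q (zs ! j) = 0" if "j < d" for j
  proof -
    have "0 = vec_index (transpose_mat ?V *\<^sub>v c) j" using c that by simp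
    also have "\<dots> = (\<Sum>i<d. (zs ! j) ^ i * vec_index c i)"
      using that c by (subst index_mult_mat_vec) (auto simp: scalar_prod_def atLeast0LessThan intro!: sum.cong)
    also have "\<dots> = poly q (zs ! j)"
      by (simp add: q_def poly_sum poly_monom mult.commute)
    finally show ?thesis by simp
  qed
  have coeff_q: "coeff q i = vec_index c i" if "i < d" for i
    using that by (simp add: q_def coeff_sum)
  show False
  proof (cases "q = 0")
    case True
    then show False using c coeff_q by (auto simp: vec_eq_iff)
  next
    case False
    have "d > 0" using c by (cases d) auto
    have "degree q \<le> d - 1" unfolding q_def
      by (rule degree_sum_le) (auto intro: order.trans[OF degree_monom_le])
    moreover have "set zs \<subseteq> {x. poly q x = 0}" using root assms by (auto simp: in_set_conv_nth)
    then have "card (set zs) \<le> card {x. poly q x = 0}"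
      by (intro card_mono poly_roots_finite False) auto
    moreover have "card {x. poly q x = 0} \<le> degree q" using False by (rule poly_roots_degree)
    ultimately show False using assms \<open>d > 0\<close> by (simp add: distinct_card)
  qed
qed

text \<open>The integer matrix \<open>A\<close> of multiplication by \<open>q\<close> modulo \<open>p\<close> satisfies \<open>A V = V E\<close> with the
  Vandermonde matrix \<open>V\<close> of the roots and \<open>E\<close> the diagonal matrix of the values of \<open>q\<close>, so the product
  of these values is the integer \<open>det A\<close>.\<close>
lemma norm_prod_poly_at_roots_ge_1:
  fixes p q :: "int poly" and zs :: "complex list"
  assumes p: "lead_coeff p = 1" "degree p > 0"
    and zs: "distinct zs" "length zs = degree p" "\<And>z. z \<in> set zs \<Longrightarrow> poly (of_int_poly p) z = 0"
    and q: "\<And>z. z \<in> set zs \<Longrightarrow> poly (of_int_poly q) z \<noteq> 0"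
  shows "1 \<le> (\<Prod>z\<in>set zs. norm (poly (of_int_poly q) z))"
proof -
  let ?d = "degree p"
  \<comment> \<open>The remainders are the rows of \<open>A\<close>. At a root of \<open>p\<close>
    the multiple of \<open>p\<close> drops out, which gives \<open>A V = V E\<close> entry by
    entry.\<close>
  have "\<exists>r. \<exists>g. monom 1 i * q = p * g + r \<and> degree r < ?d" for i
    using monic_int_poly_division[OF p, of "monom 1 i * q"] by metis
  then obtain r g where r: "\<And>i. monom 1 i * q = p * g i + r i" "\<And>i. degree (r i) < ?d"
    by metis
  define A :: "int mat" where "A = mat ?d ?d (\<lambda>(i,j). coeff (r i) j)"
  let ?A = "map_mat (of_int :: int \<Rightarrow> complex) A"
  define V where "V = mat ?d ?d (\<lambda>(i,j). (zs ! j) ^ i)"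
  define E where "E = mat ?d ?d (\<lambda>(i,j). if i = j then poly (of_int_poly q) (zs ! j) else 0)"
  have A: "?A \<in> carrier_mat ?d ?d" and V: "V \<in> carrier_mat ?d ?d" and E: "E \<in> carrier_mat ?d ?d"
    by (auto simp: A_def V_def E_def)
  have r_eval: "poly (of_int_poly (r i)) z = z ^ i * poly (of_int_poly q) z" if "z \<in> set zs" for i z
  proof -
    have "poly (of_int_poly (monom 1 i * q)) z = poly (of_int_poly (p * g i + r i)) z"
      by (simp only: r)
    then show ?thesis using zs(3)[OF that] by (simp add: hom_distribs poly_monom)
  qed
  have "?A * V = V * E"
  proof (rule eq_matI)
    show "dim_row (?A * V) = dim_row (V * E)" "dim_col (?A * V) = dim_col (V * E)"
      by (auto simp: A_def V_def E_def)
    fix i j assume "i < dim_row (V * E)" "j < dim_col (V * E)"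
    then have ij: "i < ?d" "j < ?d" by (auto simp: V_def E_def)
    then have zj: "zs ! j \<in> set zs" using zs by auto
    have "(?A * V) $$ (i, j) = (\<Sum>k<?d. of_int (coeff (r i) k) * (zs ! j) ^ k)"
      using ij by (auto simp: A_def V_def scalar_prod_def atLeast0LessThan intro!: sum.cong)
    also have "\<dots> = poly (of_int_poly (r i)) (zs ! j)"
    proof -
      have "poly (of_int_poly (r i)) (zs ! j) = (\<Sum>k\<le>?d - 1. of_int (coeff (r i) k) * (zs ! j) ^ k)"
        unfolding poly_altdef using r(2)[of i] by (intro sum.mono_neutral_cong_left) (auto simp: coeff_eq_0)
      moreover have "{..?d - 1} = {..<?d}" using p(2) by auto
      ultimately show ?thesis by simp
    qed
    also have "\<dots> = (zs ! j) ^ i * poly (of_int_poly q) (zs ! j)" by (rule r_eval[OF zj])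
    also have "\<dots> = (\<Sum>k<?d. (zs ! k) ^ i * (if k = j then poly (of_int_poly q) (zs ! j) else 0))"
      using ij by (subst sum.remove[of _ j]) auto
    also have "\<dots> = (V * E) $$ (i, j)"
      using ij by (auto simp: V_def E_def scalar_prod_def atLeast0LessThan intro!: sum.cong)
    finally show "(?A * V) $$ (i, j) = (V * E) $$ (i, j)" .
  qed
  then have "det ?A * det V = det V * det E"
    by (metis det_mult[OF A V] det_mult[OF V E])
  moreover have "det V \<noteq> 0" unfolding V_def by (rule vandermonde_det_nonzero) (use zs in auto)
  ultimately have "det ?A = det E" by simp
  moreover have "det ?A = of_int (det A)" by simp
  moreover have "det E = prod_list (diag_mat E)"
    by (rule det_upper_triangular[OF _ E]) (auto simp: E_def)
  moreover have "prod_list (diag_mat E) = (\<Prod>j<?d. poly (of_int_poly q) (zs ! j))"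
    by (auto simp: prod_list_diag_prod E_def atLeast0LessThan intro!: prod.cong)
  moreover have "(\<Prod>j<?d. poly (of_int_poly q) (zs ! j)) = (\<Prod>z\<in>set zs. poly (of_int_poly q) z)"
    by (rule prod.reindex_bij_betw[OF bij_betw_nth]) (use zs in auto)
  ultimately have eq: "(of_int (det A) :: complex) = (\<Prod>z\<in>set zs. poly (of_int_poly q) z)" by simp
  also have "\<dots> \<noteq> 0" using q by simp
  finally have "det A \<noteq> 0" by simp
  then have "1 \<le> norm (of_int (det A) :: complex)" by (simp add: norm_of_int)
  then show ?thesis unfolding eq by (simp add: prod_norm)
qed

section \<open>Minimal polynomials and conjugates\<close>

text \<open>Among the monic integer polynomials vanishing at \<beta>, one of least degree is
  irreducible over the integers, hence over the rationals by Gauss's lemma.\<close>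

lemma algebraic_int_minimal_poly:
  fixes \<beta> :: real
  assumes "algebraic_int \<beta>"
  obtains p :: "int poly" where "lead_coeff p = 1" "irreducible (of_int_poly p :: rat poly)"
    "poly (of_int_poly p) \<beta> = 0"
proof -
  let ?P = "\<lambda>p :: int poly. lead_coeff p = 1 \<and> poly (of_int_poly p) \<beta> = 0"
  from assms obtain p0 :: "real poly" where p0: "lead_coeff p0 = 1" "\<forall>i. coeff p0 i \<in> \<int>" "poly p0 \<beta> = 0"
    by (auto elim: algebraic_int.cases)
  have floor_p0: "of_int_poly (map_poly floor p0) = p0"
    using p0(2) by (intro poly_eqI) (auto simp: coeff_map_poly elim: Ints_cases)
  have "poly (of_int_poly (map_poly floor p0)) \<beta> = 0" using p0(3) floor_p0 by simp
  moreover have "real_of_int (lead_coeff (map_poly floor p0)) = 1"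
    using p0(1) floor_p0 by (metis of_int_hom.degree_map_poly_hom of_int_hom.coeff_map_poly_hom)
  ultimately have "?P (map_poly floor p0)" by simp
  then obtain p where p: "?P p" and min: "\<And>q. ?P q \<Longrightarrow> degree p \<le> degree q"
    using ex_has_least_nat[of ?P _ degree] by metis
  have "degree p > 0"
  proof (rule ccontr)
    assume "\<not> degree p > 0"
    then obtain c where "p = [:c:]" by (auto elim: degree_eq_zeroE)
    then have "p = [:1:]" using p by simp
    then show False using p by simp
  qed
  have "irreducible\<^sub>d p"
  proof (rule irreducible\<^sub>dI)
    show "degree p > 0" by fact
    fix g h assume gh: "degree g > 0" "degree g < degree p" "degree h > 0" "degree h < degree p" "p = g * h"
    have lc: "lead_coeff g * lead_coeff h = 1" using p gh(5) by (simp add: lead_coeff_mult)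
    have "poly (of_int_poly g) \<beta> = 0 \<or> poly (of_int_poly h) \<beta> = 0"
      using p gh(5) by (simp add: hom_distribs)
    \<comment> \<open>The leading coefficients of the factors multiply to 1, so \<open>f\<close> or
      \<open>-f\<close> is monic and minimality applies to it.\<close>
    moreover have "degree p \<le> degree f" if f: "poly (of_int_poly f) \<beta> = 0" "f = g \<or> f = h" for f
    proof -
      have "lead_coeff f = 1 \<or> lead_coeff f = -1" using lc f zmult_eq_1_iff by metis
      then show ?thesis using min[of f] min[of "-f"] f by (auto simp: hom_distribs)
    qed
    ultimately show False using gh by fastforce
  qed
  then have "irreducible\<^sub>d (of_int_poly p :: rat poly)" by (rule irreducible\<^sub>d_int_rat)
  then have "irreducible (of_int_poly p :: rat poly)" by simp
  then show ?thesis using that p by blast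
qed

interpretation of_rat_poly_hom: map_poly_idom_hom "of_rat :: rat \<Rightarrow> 'a :: field_char_0" ..

lemma irreducible_rat_poly_bezout:
  fixes p q :: "rat poly"
  assumes "irreducible p" "\<not> p dvd q"
  obtains s t where "s * p + t * q = 1"
proof -
  have "coprime p q" using assms prime_elem_imp_coprime irreducible_imp_prime_elem by blast
  then show ?thesis using that bezout_coefficients_fst_snd[of p q]
    by (metis coprime_imp_gcd_eq_1)
qed

text \<open>A Bezout identity can be evaluated in any extension field, so coprimality over the
  rationals excludes common roots there.\<close>

lemma poly_of_rat_bezout:
  fixes z :: "'a :: field_char_0"
  assumes "s * p + t * q = 1" "poly (map_poly of_rat p) z = 0" "poly (map_poly of_rat q) z = 0"
  shows False
proof -
  have "poly (map_poly of_rat (s * p + t * q)) z = (1::'a)" using assms(1) by simp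
  then show False using assms(2,3) by (simp add: hom_distribs)
qed

lemma of_int_poly_via_rat:
  "(of_int_poly q :: 'a :: field_char_0 poly) = map_poly of_rat (of_int_poly q :: rat poly)"
  by (simp add: map_poly_map_poly o_def)

lemma poly_of_int_poly_of_real:
  "poly (of_int_poly q) (complex_of_real x) = of_real (poly (of_int_poly q) x)"
  by (induction q) (simp_all add: hom_distribs)

text \<open>An irreducible \<open>p\<close> that shares a root with \<open>q\<close> divides
  \<open>q\<close>, so vanishing passes from one conjugate to all others.\<close>

lemma rat_poly_dvd_root:
  fixes z w :: "'a :: field_char_0"
  assumes "irreducible p" "poly (map_poly of_rat p) z = 0" "poly (map_poly of_rat q) z = 0"
    "poly (map_poly of_rat p) w = 0"
  shows "poly (map_poly of_rat q) w = 0"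
proof -
  have "p dvd q" using irreducible_rat_poly_bezout[OF assms(1)] poly_of_rat_bezout assms by metis
  then obtain g where "q = p * g" by (elim dvdE)
  then show ?thesis using assms by (simp add: of_rat_poly_hom.hom_mult)
qed

text \<open>The values of \<open>q\<close> at all conjugates of \<beta> have a product of norm at
  least 1. Each of the \<open>d\<close> conjugates other than \<beta> lies in the closed unit disc
  and contributes at most \<open>Y\<close>, which keeps the value at \<beta> from being too
  small.\<close>

lemma algebraic_int_norm_bound:
  fixes \<beta> :: real
  assumes "algebraic_int \<beta>"
    and conj: "\<And>z. rat_conjugate (of_real \<beta>) z \<Longrightarrow> z \<noteq> of_real \<beta> \<Longrightarrow> norm z \<le> 1"
  obtains d :: nat where "\<And>(q :: int poly) Y. poly (of_int_poly q) \<beta> \<noteq> 0 \<Longrightarrow>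
     (\<And>z::complex. norm z \<le> 1 \<Longrightarrow> norm (poly (of_int_poly q) z) \<le> Y) \<Longrightarrow>
     1 \<le> \<bar>poly (of_int_poly q) \<beta>\<bar> * Y ^ d"
proof -
  obtain p :: "int poly" where p: "lead_coeff p = 1" "irreducible (of_int_poly p :: rat poly)"
    "poly (of_int_poly p) \<beta> = 0" using algebraic_int_minimal_poly[OF assms(1)] .
  let ?p = "of_int_poly p :: rat poly"
  let ?pc = "of_int_poly p :: complex poly"
  have deg: "degree p > 0"
  proof (rule ccontr)
    assume "\<not> degree p > 0"
    then have "degree ?p = 0" by simp
    moreover have "?p \<noteq> 0" using p(2) by (auto simp: irreducible_def)
    ultimately have "is_unit ?p" by (simp add: is_unit_iff_degree)
    then show False using p(2) by (auto simp: irreducible_def)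
  qed
  have pc: "?pc = map_poly of_rat ?p" by (rule of_int_poly_via_rat)
  have root: "poly ?pc (of_real \<beta>) = 0" using p(3) by (simp add: poly_of_int_poly_of_real)
  \<comment> \<open>\<open>p\<close> is coprime to its nonzero derivative, so its complex roots are
    simple and there are \<open>degree p\<close> of them.\<close>
  have "rsquarefree ?pc" unfolding rsquarefree_roots
  proof (intro allI notI, elim conjE)
    fix z assume z: "poly ?pc z = 0" "poly (pderiv ?pc) z = 0"
    have "degree (pderiv ?p) < degree ?p" "pderiv ?p \<noteq> 0"
      using deg by (auto simp: degree_pderiv pderiv_eq_0_iff)
    then have nd: "\<not> ?p dvd pderiv ?p" using dvd_imp_degree_le leD by blast
    have "pderiv ?pc = map_poly of_rat (pderiv ?p)"
      unfolding pc by (simp add: of_rat_hom.map_poly_pderiv)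
    then show False using irreducible_rat_poly_bezout[OF p(2) nd] poly_of_rat_bezout z pc by metis
  qed
  then have card: "card {z. poly ?pc z = 0} = degree p"
    using rsquarefree_card_degree[of ?pc] by (auto simp: rsquarefree_def)
  define zs where "zs = (SOME zs. distinct zs \<and> set zs = {z. poly ?pc z = 0})"
  have "?pc \<noteq> 0" using deg by auto
  then have zs: "distinct zs" "set zs = {z. poly ?pc z = 0}"
    using someI_ex[OF finite_distinct_list[OF poly_roots_finite[OF \<open>?pc \<noteq> 0\<close>]]] unfolding zs_def by (auto simp: conj_commute)
  have len: "length zs = degree p" using zs card by (metis distinct_card)
  show ?thesis
  proof (rule that[of "degree p - 1"])
    fix q :: "int poly" and Y :: real
    assume q: "poly (of_int_poly q) \<beta> \<noteq> 0" and Y: "\<And>z::complex. norm z \<le> 1 \<Longrightarrow> norm (poly (of_int_poly q) z) \<le> Y"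
    let ?q = "of_int_poly q :: complex poly"
    have qc: "?q = map_poly of_rat (of_int_poly q)" by (rule of_int_poly_via_rat)
    have "poly ?q (of_real \<beta>) \<noteq> 0" using q by (simp add: poly_of_int_poly_of_real)
    then have "poly ?q z \<noteq> 0" if "z \<in> set zs" for z
      using rat_poly_dvd_root[OF p(2), of z "of_int_poly q" "of_real \<beta>"] that root zs(2)
      unfolding pc qc by blast
    then have "1 \<le> (\<Prod>z\<in>set zs. norm (poly ?q z))"
      using zs len by (intro norm_prod_poly_at_roots_ge_1[OF p(1) deg]) auto
    also have "\<dots> = norm (poly ?q (of_real \<beta>)) * (\<Prod>z\<in>set zs - {of_real \<beta>}. norm (poly ?q z))"
      using root zs(2) by (intro prod.remove finite_set) auto
    also have "(\<Prod>z\<in>set zs - {of_real \<beta>}. norm (poly ?q z)) \<le> (\<Prod>z\<in>set zs - {complex_of_real \<beta>}. Y)"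
    proof (intro prod_mono conjI)
      fix z assume z: "z \<in> set zs - {complex_of_real \<beta>}"
      then have "rat_conjugate (of_real \<beta>) z" unfolding rat_conjugate_def
        using p(2) root zs(2) pc by (intro exI[of _ ?p]) auto
      then show "norm (poly ?q z) \<le> Y" using Y conj z by auto
    qed auto
    also have "\<dots> = Y ^ (degree p - 1)"
      using zs(2) card root by simp
    finally show "1 \<le> \<bar>poly (of_int_poly q) \<beta>\<bar> * Y ^ (degree p - 1)"
      by (simp add: poly_of_int_poly_of_real mult_left_mono)
  qed
qed

section \<open>Isolated digits in expansions of zero\<close>

text \<open>With \<open>y = sqrt (norm x)\<close>, one factor \<open>y ^ n\<close> of
  \<open>norm x ^ n\<close> absorbs the polynomial and the other one is summed.\<close>

lemma summable_poly_times_power: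
  fixes x :: "'a :: {real_normed_field, banach}"
  assumes "norm x < 1"
  shows "summable (\<lambda>n. of_nat (n + 1) ^ E * x ^ n)"
proof -
  have "summable (\<lambda>n. norm (of_nat (n + 1) ^ E * x ^ n))"
  proof (cases "x = 0")
    case True
    then show ?thesis
      by (intro summable_comparison_test_ev[OF _ summable_zero] eventually_sequentiallyI[of 1]) auto
  next
    case False
    define y where "y = sqrt (norm x)"
    have y: "0 < y" "y < 1" "norm x = y * y" using False assms by (auto simp: y_def)
    have "(\<lambda>n. real (n + 1) ^ E * y ^ n) \<longlonglongrightarrow> 0"
      using y(1,2) by real_asymp
    then have "eventually (\<lambda>n. real (n + 1) ^ E * y ^ n < 1) sequentially"
      by (rule order_tendstoD) simp
    then have "eventually (\<lambda>n. norm (norm (of_nat (n + 1) ^ E * x ^ n)) \<le> y ^ n) sequentially"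
    proof eventually_elim
      case (elim n)
      have "norm (norm (of_nat (n + 1) ^ E * x ^ n)) = real (n + 1) ^ E * y ^ n * y ^ n"
        using norm_of_nat[of "n + 1", where ?'a = 'a]
        by (simp add: norm_mult norm_power y(3) power_mult_distrib)
      also have "\<dots> \<le> 1 * y ^ n" using elim y by (intro mult_right_mono) auto
      finally show ?case by simp
    qed
    moreover have "summable (\<lambda>n. y ^ n)" using y by (intro summable_geometric) auto
    ultimately show ?thesis by (rule summable_comparison_test_ev)
  qed
  then show ?thesis by (rule summable_norm_cancel)
qed

text \<open>The inequality \<open>M + n + 1 \<le> (M + 1) * (n + 1)\<close> separates the position
  \<open>M\<close> from the summation index, so one \<open>K\<close> serves all tails.\<close>

lemma poly_bounded_tail:
  fixes h :: "nat \<Rightarrow> real"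
  assumes x: "0 \<le> x" "x < 1" and h: "\<And>n. \<bar>h n\<bar> \<le> C * real (n + 1) ^ E"
  obtains K where "K > 0" "\<And>M. summable (\<lambda>n. h (M + n) * x ^ n)"
    "\<And>M. \<bar>\<Sum>n. h (M + n) * x ^ n\<bar> \<le> K * real (M + 1) ^ E"
proof -
  define K where "K = C * (\<Sum>n. real (n + 1) ^ E * x ^ n)"
  have C: "C \<ge> 0" using h[of 0] by simp
  have s: "summable (\<lambda>n. real (n + 1) ^ E * x ^ n)"
    using summable_poly_times_power[of x E] x by simp
  have le: "norm (h (M + n) * x ^ n) \<le> C * real (M + 1) ^ E * (real (n + 1) ^ E * x ^ n)" for M n
  proof -
    have "real (M + n + 1) ^ E \<le> (real (M + 1) * real (n + 1)) ^ E"
      by (intro power_mono) (auto simp: field_simps)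
    then have "C * real (M + n + 1) ^ E \<le> C * (real (M + 1) * real (n + 1)) ^ E"
      using C by (rule mult_left_mono)
    then have "\<bar>h (M + n)\<bar> * x ^ n \<le> C * (real (M + 1) * real (n + 1)) ^ E * x ^ n"
      using h[of "M + n"] x by (intro mult_right_mono) auto
    then show ?thesis using x by (simp add: abs_mult power_mult_distrib mult_ac)
  qed
  show ?thesis
  \<comment> \<open>\<open>K\<close> itself is 0 when \<open>C = 0\<close>; adding 1 makes the
    constant positive.\<close>
  proof (rule that[of "K + 1"])
    have K0: "K \<ge> 0" unfolding K_def using C x by (intro mult_nonneg_nonneg suminf_nonneg s) auto
    then show "K + 1 > 0" by simp
    fix M
    have s': "summable (\<lambda>n. C * real (M + 1) ^ E * (real (n + 1) ^ E * x ^ n))"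
      by (intro summable_mult s)
    show "summable (\<lambda>n. h (M + n) * x ^ n)"
      by (rule summable_comparison_test'[OF s' le])
    have "\<bar>\<Sum>n. h (M + n) * x ^ n\<bar> \<le> (\<Sum>n. C * real (M + 1) ^ E * (real (n + 1) ^ E * x ^ n))"
      using summable_comparison_test'[OF s' le] norm_suminf_le[OF le s'] by simp
    also have "\<dots> = K * real (M + 1) ^ E"
      by (subst suminf_mult[OF s]) (simp add: K_def)
    also have "\<dots> \<le> (K + 1) * real (M + 1) ^ E" by (intro mult_right_mono) auto
    finally show "\<bar>\<Sum>n. h (M + n) * x ^ n\<bar> \<le> (K + 1) * real (M + 1) ^ E" .
  qed
qed

text \<open>The partial sum before a zero block of length \<open>W\<close> is an element of \<open>\<int>[\<beta>]\<close> of size about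
  \<open>\<beta>\<^sup>-\<^sup>W\<close> with polynomially bounded conjugates, so it vanishes, and then so does the tail, which is
  impossible if its leading digits are nonnegative and the first one is positive.\<close>
lemma no_isolated_positive_digit:
  fixes \<beta> :: real and h :: "nat \<Rightarrow> int"
  assumes "algebraic_int \<beta>" and \<beta>: "\<beta> > 1"
    and conj: "\<And>z. rat_conjugate (of_real \<beta>) z \<Longrightarrow> z \<noteq> of_real \<beta> \<Longrightarrow> norm z \<le> 1"
    and h: "\<And>n. \<bar>real_of_int (h n)\<bar> \<le> C * real (n + 1) ^ E"
    and h0: "(\<lambda>n. h n * (1 / \<beta>) ^ n) sums 0"
  obtains B N0 where "B > 0" "\<forall>N\<ge>N0. \<forall>z\<le>N. \<forall>W\<le>N. B * ln (real N) \<le> real W \<longrightarrow>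
      \<not> (h z > 0 \<and> (\<forall>n<z. z \<le> n + W \<longrightarrow> h n = 0) \<and> (\<forall>n. z < n \<longrightarrow> n \<le> z + W \<longrightarrow> h n \<ge> 0))"
proof -
  obtain d where d: "\<And>(q :: int poly) Y. poly (of_int_poly q) \<beta> \<noteq> 0 \<Longrightarrow>
     (\<And>z::complex. norm z \<le> 1 \<Longrightarrow> norm (poly (of_int_poly q) z) \<le> Y) \<Longrightarrow>
     1 \<le> \<bar>poly (of_int_poly q) \<beta>\<bar> * Y ^ d"
    using algebraic_int_norm_bound[OF assms(1) conj] by blast
  define x where "x = 1 / \<beta>"
  have x: "0 < x" "x < 1" using \<beta> by (auto simp: x_def)
  have C: "C \<ge> 0" using h[of 0] by simp
  obtain K where K: "K > 0" and summ: "\<And>M. summable (\<lambda>n. real_of_int (h (M + n)) * x ^ n)"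
    and tail: "\<And>M. \<bar>\<Sum>n. real_of_int (h (M + n)) * x ^ n\<bar> \<le> K * real (M + 1) ^ E"
    by (rule poly_bounded_tail[OF less_imp_le[OF x(1)] x(2) h]) (rule that)
  \<comment> \<open>\<open>D\<close> is the total exponent of \<open>N + 1\<close> in the norm
    estimate below: \<open>E\<close> from the tail and \<open>E + 1\<close> from each of the
    \<open>d\<close> other conjugates. \<open>B\<close> is chosen such that
    \<open>\<beta> ^ W\<close> is at least \<open>N ^ (D + 1)\<close>; the spare factor
    \<open>N\<close> beats the constants collected in \<open>N0\<close>.\<close>
  define D where "D = E + (E + 1) * d"
  define B where "B = real (D + 1) / ln \<beta>"
  define N0 where "N0 = nat \<lceil>K * C ^ d * 2 ^ D\<rceil> + nat \<lceil>K * 4 ^ E\<rceil> + 2"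
  have B: "B > 0" using \<beta> by (simp add: B_def)
  show ?thesis
  proof (rule that[of B N0], rule B, intro allI impI notI, elim conjE)
    fix N z W assume N: "N0 \<le> N" and zN: "z \<le> N" and WN: "W \<le> N" and W: "B * ln (real N) \<le> real W"
      and pos: "0 < h z" and zero: "\<forall>n<z. z \<le> n + W \<longrightarrow> h n = 0"
      and nonneg: "\<forall>n. z < n \<longrightarrow> n \<le> z + W \<longrightarrow> 0 \<le> h n"
    have N2: "N \<ge> 2" using N by (simp add: N0_def)
    have less: "y < real N" if "nat \<lceil>y\<rceil> + 2 \<le> N" for y using that by linarith
    have N_C: "K * C ^ d * 2 ^ D < real N" and N_E: "K * 4 ^ E < real N"
      by (rule less, use N in \<open>simp add: N0_def\<close>)+
    have xW: "x ^ W * real N ^ (D + 1) \<le> 1"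
    proof -
      have "real (D + 1) * ln N \<le> real W * ln \<beta>"
        using W \<beta> by (simp add: B_def field_simps)
      then have "ln (real N ^ (D + 1)) \<le> ln (\<beta> ^ W)"
        using N2 \<beta> by (subst (1 2) ln_realpow) auto
      then have "real N ^ (D + 1) \<le> \<beta> ^ W" using N2 \<beta> by (subst (asm) ln_le_cancel_iff) auto
      then show ?thesis using \<beta> by (simp add: x_def field_simps)
    qed
    \<comment> \<open>The zero block erases the digits from \<open>M\<close> to
      \<open>z - 1\<close>, so the partial sum before \<open>z\<close>, scaled by
      \<open>\<beta> ^ M\<close>, is the value at \<beta> of the integer polynomial
      \<open>q\<close>. For \<open>z \<le> W\<close> the truncated difference gives
      \<open>M = 0\<close> and \<open>q = 0\<close>.\<close>
    define M where "M = z - W"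
    define q where "q = (\<Sum>n<M. monom (h n) (M - n))"
    have q_eval: "poly (of_int_poly q) w = (\<Sum>n<M. of_int (h n) * w ^ (M - n))" for w :: "'b::field_char_0"
      by (simp add: q_def hom_distribs poly_sum poly_monom)
    define T where "T = (\<Sum>n. real_of_int (h (z + n)) * x ^ n)"
    have q_beta: "poly (of_int_poly q) \<beta> = - (x ^ (z - M) * T)"
    proof -
      have sum0: "summable (\<lambda>n. real_of_int (h n) * x ^ n)" using summ[of 0] by simp
      have "0 = (\<Sum>n. real_of_int (h n) * x ^ n)" using h0 by (simp add: x_def sums_iff)
      also have "\<dots> = (\<Sum>n. real_of_int (h (n + z)) * x ^ (n + z)) + (\<Sum>n<z. real_of_int (h n) * x ^ n)"
        by (rule suminf_split_initial_segment[OF sum0])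
      also have "(\<Sum>n. real_of_int (h (n + z)) * x ^ (n + z)) = x ^ z * T"
        unfolding T_def using summ[of z] by (subst suminf_mult[symmetric]) (auto simp: power_add mult_ac add_ac)
      also have "(\<Sum>n<z. real_of_int (h n) * x ^ n) = (\<Sum>n<M. real_of_int (h n) * x ^ n)"
        by (rule sum.mono_neutral_right) (auto simp: M_def zero)
      finally have "(\<Sum>n<M. real_of_int (h n) * x ^ n) = - (x ^ z * T)" by simp
      then have "\<beta> ^ M * (\<Sum>n<M. real_of_int (h n) * x ^ n) = - (\<beta> ^ M * x ^ z * T)" by simp
      also have "\<beta> ^ M * x ^ z = x ^ (z - M)"
        using \<beta> by (simp add: x_def M_def field_simps flip: power_add)
      also have "\<beta> ^ M * (\<Sum>n<M. real_of_int (h n) * x ^ n) = poly (of_int_poly q) \<beta>"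
        unfolding q_eval sum_distrib_left
        by (intro sum.cong) (use \<beta> in \<open>auto simp: x_def field_simps power_diff\<close>)
      finally show ?thesis .
    qed
    have N1: "real (N + 1) \<le> 2 * real N" using N2 by simp
    have T_le: "\<bar>T\<bar> \<le> K * real (N + 1) ^ E"
    proof -
      have "\<bar>T\<bar> \<le> K * real (z + 1) ^ E" unfolding T_def by (rule tail)
      also have "\<dots> \<le> K * real (N + 1) ^ E"
        using zN K by (intro mult_left_mono power_mono) auto
      finally show ?thesis .
    qed
    have "T = 0"
    proof (rule ccontr)
      assume "T \<noteq> 0"
      then have q0: "poly (of_int_poly q) \<beta> \<noteq> 0" using x by (simp add: q_beta)
      have "M > 0" using q0 by (cases "M = 0") (auto simp: q_def)
      then have zM: "z - M = W" by (simp add: M_def)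
      have "1 \<le> \<bar>poly (of_int_poly q) \<beta>\<bar> * (C * real (N + 1) ^ (E + 1)) ^ d"
      proof (rule d[OF q0])
        fix w :: complex assume w: "norm w \<le> 1"
        have "norm (poly (of_int_poly q) w) \<le> (\<Sum>n<M. norm (of_int (h n) * w ^ (M - n)))"
          unfolding q_eval by (rule norm_sum)
        also have "\<dots> \<le> (\<Sum>n<M. C * real (N + 1) ^ E)"
        proof (rule sum_mono)
          fix n assume "n \<in> {..<M}"
          have "norm (of_int (h n) * w ^ (M - n)) \<le> C * real (n + 1) ^ E * 1"
            unfolding norm_mult norm_power norm_of_int using h[of n] w C by (intro mult_mono power_le_one) auto
          also have "\<dots> \<le> C * real (N + 1) ^ E * 1"
            using C zN \<open>n \<in> {..<M}\<close> by (intro mult_mono power_mono) (auto simp: M_def)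
          finally show "norm (of_int (h n) * w ^ (M - n)) \<le> C * real (N + 1) ^ E" by simp
        qed
        also have "\<dots> = real M * (C * real (N + 1) ^ E)" by simp
        also have "\<dots> \<le> real (N + 1) * (C * real (N + 1) ^ E)"
          using C zN by (intro mult_right_mono) (auto simp: M_def)
        finally show "norm (poly (of_int_poly q) w) \<le> C * real (N + 1) ^ (E + 1)" by (simp add: mult_ac)
      qed
      also have "\<bar>poly (of_int_poly q) \<beta>\<bar> \<le> x ^ W * (K * real (N + 1) ^ E)"
        using T_le x by (simp add: q_beta zM abs_mult)
      then have "\<bar>poly (of_int_poly q) \<beta>\<bar> * (C * real (N + 1) ^ (E + 1)) ^ d
          \<le> x ^ W * (K * real (N + 1) ^ E) * (C * real (N + 1) ^ (E + 1)) ^ d"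
        using C by (intro mult_right_mono) auto
      also have "\<dots> = x ^ W * (K * C ^ d) * real (N + 1) ^ D"
        by (simp add: D_def power_mult_distrib power_add power_mult mult_ac flip: power_mult)
      also have "\<dots> \<le> x ^ W * (K * C ^ d) * (2 * real N) ^ D"
        using x K C N1 by (intro mult_left_mono power_mono) auto
      also have "\<dots> = x ^ W * (real N ^ D * (K * C ^ d * 2 ^ D))" by (simp add: power_mult_distrib mult_ac)
      also have "\<dots> < x ^ W * (real N ^ D * real N)"
        using x N_C N2 by (intro mult_strict_left_mono) auto
      also have "\<dots> \<le> 1" using xW by (simp add: mult_ac)
      finally show False by simp
    qed
    \<comment> \<open>As \<open>T = 0\<close>, the \<open>W + 1\<close> leading terms of the tail
      sum to minus a remainder of absolute value less than 1, whereas nonnegativity makes this sum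
      at least \<open>h z\<close>.\<close>
    have "T = (\<Sum>n. real_of_int (h (z + (n + (W + 1)))) * x ^ (n + (W + 1))) + (\<Sum>n<W + 1. real_of_int (h (z + n)) * x ^ n)"
      unfolding T_def by (rule suminf_split_initial_segment[OF summ])
    also have "(\<Sum>n. real_of_int (h (z + (n + (W + 1)))) * x ^ (n + (W + 1)))
       = x ^ (W + 1) * (\<Sum>n. real_of_int (h ((z + W + 1) + n)) * x ^ n)"
      by (subst suminf_mult[OF summ, symmetric]) (auto simp: power_add mult_ac add_ac)
    finally have "(\<Sum>n<W + 1. real_of_int (h (z + n)) * x ^ n) =
        - (x ^ (W + 1) * (\<Sum>n. real_of_int (h ((z + W + 1) + n)) * x ^ n))"
      using \<open>T = 0\<close> by simp
    also have "\<dots> \<le> \<bar>x ^ (W + 1) * (\<Sum>n. real_of_int (h ((z + W + 1) + n)) * x ^ n)\<bar>"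
      by linarith
    also have "\<dots> \<le> x ^ (W + 1) * (K * real (z + W + 1 + 1) ^ E)"
      using tail[of "z + W + 1"] x by (simp add: abs_mult)
    also have "\<dots> \<le> x ^ W * (K * (4 * real N) ^ E)"
      using x K zN WN N2 by (intro mult_mono power_mono power_decreasing) auto
    also have "\<dots> = x ^ W * (K * 4 ^ E * real N ^ E)" by (simp add: power_mult_distrib)
    also have "\<dots> < x ^ W * (real N * real N ^ E)"
      using x N_E N2 by (intro mult_strict_left_mono mult_strict_right_mono) auto
    also have "\<dots> = x ^ W * real N ^ (E + 1)" by simp
    also have "\<dots> \<le> x ^ W * real N ^ (D + 1)"
      using x N2 by (intro mult_left_mono power_increasing) (auto simp: D_def)
    also have "\<dots> \<le> 1" by (rule xW)
    finally have "(\<Sum>n<W + 1. real_of_int (h (z + n)) * x ^ n) < 1" .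
    moreover have "(\<Sum>n\<in>{0}. real_of_int (h (z + n)) * x ^ n) \<le> (\<Sum>n<W + 1. real_of_int (h (z + n)) * x ^ n)"
      using x nonneg by (intro sum_mono2) auto
    ultimately show False using pos by simp
  qed
qed

section \<open>Supports of power series\<close>

definition fps_supp :: "real fps \<Rightarrow> nat set" where
  "fps_supp f = {n. fps_nth f n \<noteq> 0}"

text \<open>The coefficients are real numbers with integer values, so that \<open>eval_fps\<close>
  and the theory of convergence apply. Polynomial growth is preserved by products, whereas
  boundedness is not.\<close>

definition digit_series :: "real fps \<Rightarrow> bool" where
  "digit_series f \<longleftrightarrow> (\<forall>n. fps_nth f n \<in> \<int>) \<and> (\<exists>C E. \<forall>n. \<bar>fps_nth f n\<bar> \<le> C * real (n + 1) ^ E)"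

lemma digit_seriesE:
  assumes "digit_series f"
  obtains C E where "C \<ge> 0" "\<And>n. \<bar>fps_nth f n\<bar> \<le> C * real (n + 1) ^ E"
proof -
  obtain C E where CE: "\<And>n. \<bar>fps_nth f n\<bar> \<le> C * real (n + 1) ^ E"
    using assms unfolding digit_series_def by blast
  have "0 \<le> \<bar>fps_nth f 0\<bar>" by simp
  also have "\<dots> \<le> C" using CE[of 0] by simp
  finally show ?thesis using that CE by blast
qed

lemma digit_series_add:
  assumes "digit_series f" "digit_series g"
  shows "digit_series (f + g)"
proof -
  obtain C E where f: "C \<ge> 0" "\<And>n. \<bar>fps_nth f n\<bar> \<le> C * real (n + 1) ^ E"
    using assms(1) by (rule digit_seriesE) (rule that)
  obtain C' E' where g: "C' \<ge> 0" "\<And>n. \<bar>fps_nth g n\<bar> \<le> C' * real (n + 1) ^ E'"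
    using assms(2) by (rule digit_seriesE) (rule that)
  have "\<bar>fps_nth (f + g) n\<bar> \<le> (C + C') * real (n + 1) ^ (E + E')" for n
  proof -
    have "\<bar>fps_nth (f + g) n\<bar> \<le> \<bar>fps_nth f n\<bar> + \<bar>fps_nth g n\<bar>" by simp
    also have "\<dots> \<le> C * real (n + 1) ^ E + C' * real (n + 1) ^ E'" by (intro add_mono f g)
    also have "\<dots> \<le> C * real (n + 1) ^ (E + E') + C' * real (n + 1) ^ (E + E')"
      by (intro add_mono mult_left_mono power_increasing f g) auto
    finally show ?thesis by (simp only: distrib_right)
  qed
  moreover have "fps_nth (f + g) n \<in> \<int>" for n using assms by (simp add: digit_series_def)
  ultimately show ?thesis unfolding digit_series_def by blast
qed

lemma digit_series_mult:
  assumes "digit_series f" "digit_series g"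
  shows "digit_series (f * g)"
proof -
  obtain C E where f: "C \<ge> 0" "\<And>n. \<bar>fps_nth f n\<bar> \<le> C * real (n + 1) ^ E"
    using assms(1) by (rule digit_seriesE) (rule that)
  obtain C' E' where g: "C' \<ge> 0" "\<And>n. \<bar>fps_nth g n\<bar> \<le> C' * real (n + 1) ^ E'"
    using assms(2) by (rule digit_seriesE) (rule that)
  have "\<bar>fps_nth (f * g) n\<bar> \<le> (C * C') * real (n + 1) ^ (E + E' + 1)" for n
  proof -
    have "\<bar>fps_nth (f * g) n\<bar> \<le> (\<Sum>i=0..n. \<bar>fps_nth f i * fps_nth g (n - i)\<bar>)"
      unfolding fps_mult_nth by (rule sum_abs)
    also have "\<dots> \<le> (\<Sum>i=0..n. (C * real (n + 1) ^ E) * (C' * real (n + 1) ^ E'))"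
    proof (rule sum_mono)
      fix i assume i: "i \<in> {0..n}"
      have "\<bar>fps_nth f i\<bar> \<le> C * real (n + 1) ^ E"
        by (rule order.trans[OF f(2)]) (use i f(1) in \<open>intro mult_left_mono power_mono, auto\<close>)
      moreover have "\<bar>fps_nth g (n - i)\<bar> \<le> C' * real (n + 1) ^ E'"
        by (rule order.trans[OF g(2)]) (use i g(1) in \<open>intro mult_left_mono power_mono, auto\<close>)
      ultimately show "\<bar>fps_nth f i * fps_nth g (n - i)\<bar> \<le> (C * real (n + 1) ^ E) * (C' * real (n + 1) ^ E')"
        unfolding abs_mult using f(1) by (intro mult_mono) auto
    qed
    also have "\<dots> = (C * C') * real (n + 1) ^ (E + E' + 1)"
      by (simp add: power_add algebra_simps)
    finally show ?thesis .
  qed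
  moreover have "fps_nth (f * g) n \<in> \<int>" for n
    unfolding fps_mult_nth using assms by (auto simp: digit_series_def intro!: Ints_sum Ints_mult)
  ultimately show ?thesis unfolding digit_series_def by blast
qed

lemma digit_series_bounded:
  assumes "\<And>n. fps_nth f n \<in> \<int>" "\<And>n. \<bar>fps_nth f n\<bar> \<le> C"
  shows "digit_series f"
  unfolding digit_series_def using assms by (intro conjI allI exI[of _ C] exI[of _ 0]) auto

lemma digit_series_of_int: "digit_series (fps_const (of_int c))"
  by (rule digit_series_bounded[of _ "\<bar>of_int c\<bar>"]) auto

lemma digit_series_X_power: "digit_series (fps_X ^ e)"
  by (rule digit_series_bounded[of _ 1]) (auto simp: fps_X_power_nth)

lemma digit_series_power: "digit_series f \<Longrightarrow> digit_series (f ^ k)"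
proof (induction k)
  case 0
  show ?case using digit_series_of_int[of 1] by simp
qed (auto intro: digit_series_mult)

lemma digit_series_sum: "(\<And>i. i \<in> I \<Longrightarrow> digit_series (f i)) \<Longrightarrow> digit_series (\<Sum>i\<in>I. f i)"
proof (induction I rule: infinite_finite_induct)
  case (insert x F)
  then show ?case by (auto intro: digit_series_add)
qed (use digit_series_of_int[of 0] in auto)

lemma digit_series_conv_radius:
  assumes "digit_series f" "norm x < 1"
  shows "ereal (norm x) < fps_conv_radius f"
proof -
  \<comment> \<open>Convergence at a point strictly between \<open>norm x\<close> and 1 yields the
    strict inequality.\<close>
  define y where "y = (1 + norm x) / 2"
  have y: "0 \<le> y" "norm x < y" "y < 1" using assms(2) by (auto simp: y_def add_nonneg_nonneg)
  obtain C E where f: "C \<ge> 0" "\<And>n. \<bar>fps_nth f n\<bar> \<le> C * real (n + 1) ^ E"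
    using assms(1) by (rule digit_seriesE) (rule that)
  have "summable (\<lambda>n. C * (real (n + 1) ^ E * y ^ n))"
    using summable_poly_times_power[of y E] y by (intro summable_mult) auto
  then have "summable (\<lambda>n. fps_nth f n * y ^ n)"
  proof (rule summable_comparison_test')
    fix n
    show "norm (fps_nth f n * y ^ n) \<le> C * (real (n + 1) ^ E * y ^ n)"
      using mult_right_mono[OF f(2)[of n], of "y ^ n"] y(1) by (simp add: abs_mult mult_ac)
  qed
  then have "ereal (norm y) \<le> fps_conv_radius f"
    unfolding fps_conv_radius_def by (rule conv_radius_geI)
  moreover have "ereal (norm x) < ereal (norm y)" using y by simp
  ultimately show ?thesis by (rule order.strict_trans2[rotated])
qed

text \<open>Without negative coefficients nothing cancels in a product, so its support is the full
  sumset of the two supports.\<close>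

definition nonneg_fps :: "real fps \<Rightarrow> bool" where
  "nonneg_fps f \<longleftrightarrow> (\<forall>n. fps_nth f n \<ge> 0)"

lemma nonneg_fps_mult: "nonneg_fps f \<Longrightarrow> nonneg_fps g \<Longrightarrow> nonneg_fps (f * g)"
  by (auto simp: nonneg_fps_def fps_mult_nth intro!: sum_nonneg mult_nonneg_nonneg)

lemma nonneg_fps_power: "nonneg_fps f \<Longrightarrow> nonneg_fps (f ^ k)"
proof (induction k)
  case 0
  then show ?case by (simp add: nonneg_fps_def)
qed (simp add: nonneg_fps_mult)

lemma fps_supp_multD:
  assumes "n \<in> fps_supp (f * g)"
  obtains i j where "i \<in> fps_supp f" "j \<in> fps_supp g" "n = i + j"
proof -
  have "(\<Sum>i=0..n. fps_nth f i * fps_nth g (n - i)) \<noteq> 0"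
    using assms by (simp add: fps_supp_def fps_mult_nth)
  then obtain i where "i \<in> {0..n}" "fps_nth f i * fps_nth g (n - i) \<noteq> 0"
    by (rule sum.not_neutral_contains_not_neutral)
  then show ?thesis by (intro that[of i "n - i"]) (auto simp: fps_supp_def)
qed

lemma fps_supp_multI:
  assumes "nonneg_fps f" "nonneg_fps g" "i \<in> fps_supp f" "j \<in> fps_supp g"
  shows "i + j \<in> fps_supp (f * g)"
proof -
  have "0 < fps_nth f i * fps_nth g (i + j - i)"
    using assms by (simp add: fps_supp_def nonneg_fps_def less_le)
  also have "\<dots> \<le> (\<Sum>k=0..i+j. fps_nth f k * fps_nth g (i + j - k))"
    using assms(1,2) by (intro member_le_sum) (auto simp: nonneg_fps_def)
  finally show ?thesis by (simp add: fps_supp_def fps_mult_nth)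
qed

text \<open>The exponent 0 serves as an additional summand. Hence the supports of the powers form an
  increasing chain, and one high power covers all lower terms.\<close>

lemma fps_supp_power_Suc_mono:
  assumes "nonneg_fps f" "0 \<in> fps_supp f" "i \<le> j"
  shows "fps_supp (f ^ i) \<subseteq> fps_supp (f ^ j)"
  using assms(3)
proof (induction j rule: dec_induct)
  case (step j)
  then show ?case
    using fps_supp_multI[OF assms(1) nonneg_fps_power[OF assms(1)] assms(2), of _ j] by auto
qed simp

lemma zero_in_fps_supp_power: "0 \<in> fps_supp f \<Longrightarrow> 0 \<in> fps_supp (f ^ k)"
  by (simp add: fps_supp_def)

lemma fps_supp_mult_mono:
  assumes "nonneg_fps f'" "nonneg_fps g'" "fps_supp f \<subseteq> fps_supp f'" "fps_supp g \<subseteq> fps_supp g'"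
  shows "fps_supp (f * g) \<subseteq> fps_supp (f' * g')"
  using assms by (blast elim: fps_supp_multD intro: fps_supp_multI)

lemma card_fps_supp_mult_le:
  "card (fps_supp (f * g) \<inter> {..<N}) \<le> card (fps_supp f \<inter> {..<N}) * card (fps_supp g \<inter> {..<N})"
proof -
  let ?S = "(fps_supp f \<inter> {..<N}) \<times> (fps_supp g \<inter> {..<N})"
  have "fps_supp (f * g) \<inter> {..<N} \<subseteq> (\<lambda>(i, j). i + j) ` ?S"
    by (fastforce elim: fps_supp_multD)
  then have "card (fps_supp (f * g) \<inter> {..<N}) \<le> card ((\<lambda>(i, j). i + j) ` ?S)"
    by (intro card_mono) auto
  also have "\<dots> \<le> card ?S" by (rule card_image_le) auto
  finally show ?thesis by (simp add: card_cartesian_product)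
qed

lemma card_fps_supp_power_le: "card (fps_supp (f ^ k) \<inter> {..<N}) \<le> card (fps_supp f \<inter> {..<N}) ^ k"
proof (induction k)
  case 0
  have "card (fps_supp 1 \<inter> {..<N}) \<le> card {0::nat}"
    by (intro card_mono) (auto simp: fps_supp_def split: if_splits)
  then show ?case by simp
next
  case (Suc k)
  have "card (fps_supp (f ^ Suc k) \<inter> {..<N}) \<le> card (fps_supp f \<inter> {..<N}) * card (fps_supp (f ^ k) \<inter> {..<N})"
    using card_fps_supp_mult_le[of f "f ^ k"] by simp
  also have "\<dots> \<le> card (fps_supp f \<inter> {..<N}) * card (fps_supp f \<inter> {..<N}) ^ k"
    by (intro mult_left_mono Suc) auto
  finally show ?case by simp
qed

lemma card_fps_supp_power_mult_power_le:
  "card (fps_supp (f ^ i * g ^ j) \<inter> {..<N}) \<le> card (fps_supp f \<inter> {..<N}) ^ i * card (fps_supp g \<inter> {..<N}) ^ j"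
  by (rule order.trans[OF card_fps_supp_mult_le]) (intro mult_le_mono card_fps_supp_power_le)

section \<open>Isolating a coefficient of the leading term\<close>

text \<open>From \<open>s\<close>, jump to a further element of \<open>S\<close> within distance
  \<open>g\<close> as long as there is one; \<open>c\<close> jumps would exhibit
  \<open>c + 1\<close> elements in the interval.\<close>

lemma gap_to_the_right:
  fixes s :: nat
  assumes "s \<in> S" "card (S \<inter> {s..s + c * g}) \<le> c"
  obtains y where "y \<in> S" "s \<le> y" "y \<le> s + c * g" "S \<inter> {y<..y + g} = {}"
proof -
  have "\<exists>y\<in>S. s \<le> y \<and> y \<le> s + c * g \<and> S \<inter> {y<..y + g} = {}"
    using assms
  proof (induction c arbitrary: s)
    case 0
    then have "S \<inter> {s..s + 0 * g} = {s}" by auto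
    then show ?case using 0 by (metis One_nat_def card_1_singleton_iff not_one_le_zero)
  next
    case (Suc c)
    show ?case
    proof (cases "S \<inter> {s<..s + g} = {}")
      case True
      then show ?thesis using Suc.prems by (intro bexI[of _ s]) auto
    next
      case False
      then obtain s' where s': "s' \<in> S" "s < s'" "s' \<le> s + g" by auto
      have "insert s (S \<inter> {s'..s' + c * g}) \<subseteq> S \<inter> {s..s + Suc c * g}"
        using s' Suc.prems(1) by auto
      then have "card (insert s (S \<inter> {s'..s' + c * g})) \<le> Suc c"
        using Suc.prems(2) by (meson card_mono finite_Int finite_atLeastAtMost order.trans)
      then have "card (S \<inter> {s'..s' + c * g}) \<le> c" using s' by simp
      from Suc.IH[OF s'(1) this] obtain y where "y \<in> S" "s' \<le> y" "y \<le> s' + c * g" "S \<inter> {y<..y + g} = {}"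
        by blast
      then show ?thesis using s' by (intro bexI[of _ y]) auto
    qed
  qed
  then show ?thesis using that by blast
qed

text \<open>The same walk in the other direction. The additive form \<open>n + g < y\<close> of the
  gap avoids truncated subtraction.\<close>

lemma gap_to_the_left:
  fixes s :: nat
  assumes "s \<in> S" "card (S \<inter> {..s}) \<le> c"
  obtains y where "y \<in> S" "y \<le> s" "s \<le> y + c * g" "\<And>n. n \<in> S \<Longrightarrow> n < y \<Longrightarrow> n + g < y"
proof -
  have "\<exists>y\<in>S. y \<le> s \<and> s \<le> y + c * g \<and> (\<forall>n\<in>S. n < y \<longrightarrow> n + g < y)"
    using assms
  proof (induction c arbitrary: s)
    case 0
    then show ?case by auto
  next
    case (Suc c)
    show ?case
    proof (cases "\<forall>n\<in>S. n < s \<longrightarrow> n + g < s")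
      case True
      then show ?thesis using Suc.prems by (intro bexI[of _ s]) auto
    next
      case False
      then obtain s' where s': "s' \<in> S" "s' < s" "s \<le> s' + g" by auto
      have "insert s (S \<inter> {..s'}) \<subseteq> S \<inter> {..s}"
        using s' Suc.prems(1) by auto
      then have "card (insert s (S \<inter> {..s'})) \<le> Suc c"
        using Suc.prems(2) by (meson card_mono finite_Int finite_atMost order.trans)
      then have "card (S \<inter> {..s'}) \<le> c" using s' by simp
      from Suc.IH[OF s'(1) this] obtain y where "y \<in> S" "y \<le> s'" "s' \<le> y + c * g" "\<forall>n\<in>S. n < y \<longrightarrow> n + g < y"
        by blast
      then show ?thesis using s' by (intro bexI[of _ y]) auto
    qed
  qed
  then show ?thesis using that by blast
qed

section \<open>Integer polynomials in two power series\<close>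

text \<open>The shifts \<open>e p\<close> compensate for the powers of \<beta> that are split off
  when the exponents of \<open>F\<close> and \<open>G\<close> are normalised to start at 0.\<close>

definition fps_bipoly :: "(nat \<times> nat) set \<Rightarrow> (nat \<times> nat \<Rightarrow> int) \<Rightarrow> (nat \<times> nat \<Rightarrow> nat) \<Rightarrow> real fps \<Rightarrow> real fps \<Rightarrow> real fps" where
  "fps_bipoly I c e F G = (\<Sum>p\<in>I. fps_const (of_int (c p)) * (fps_X ^ e p * (F ^ fst p * G ^ snd p)))"

lemma fps_nth_bipoly:
  "fps_nth (fps_bipoly I c e F G) n =
    (\<Sum>p\<in>I. of_int (c p) * (if n < e p then 0 else fps_nth (F ^ fst p * G ^ snd p) (n - e p)))"
  by (simp add: fps_bipoly_def fps_sum_nth fps_X_power_mult_nth)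

lemma digit_series_bipoly:
  "digit_series F \<Longrightarrow> digit_series G \<Longrightarrow> digit_series (fps_bipoly I c e F G)"
  unfolding fps_bipoly_def
  by (intro digit_series_sum digit_series_mult digit_series_of_int digit_series_X_power digit_series_power)

text \<open>All scales are powers of \<open>q = N\<^bsup>1/16\<^esup>\<close>: a support point \<open>s\<close> of \<open>F\<^sup>k\<close> is at distance \<open>q\<^sup>1\<^sup>2\<close> from the
  terms with \<open>i < k\<close>, moving right by at most \<open>q\<^sup>1\<^sup>0 + q\<^sup>8\<close> also avoids the terms with \<open>i = k\<close>, \<open>j < l\<close> by
  about \<open>q\<^sup>3\<close>, and moving left by at most \<open>q\<^sup>2\<close> creates a gap of length \<open>q\<close> in the support of \<open>F\<^sup>k G\<^sup>l\<close>.\<close>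
lemma isolated_top_digit:
  fixes F G :: "real fps" and c :: "nat \<times> nat \<Rightarrow> int" and e :: "nat \<times> nat \<Rightarrow> nat"
  assumes nn: "nonneg_fps F" "nonneg_fps G" and z: "0 \<in> fps_supp F" "0 \<in> fps_supp G"
    and I: "finite I" "(k, l) \<in> I" "c (k, l) > 0"
    and lex: "\<And>i j. (i, j) \<in> I \<Longrightarrow> i < k \<or> i = k \<and> j \<le> l"
    and sparse: "\<And>i j. \<forall>\<^sub>F q in sequentially. card (fps_supp (F ^ i * G ^ j) \<inter> {..<3 * q ^ 16}) \<le> q"
    and isol: "\<And>J. k > 0 \<Longrightarrow> \<forall>\<^sub>F q in sequentially. \<exists>s\<in>fps_supp (F ^ k). s \<le> q ^ 16 \<and>
        (\<forall>t\<in>fps_supp (F ^ (k - 1) * G ^ J). t + q ^ 12 < s \<or> s + q ^ 12 < t)"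
    and dense: "\<forall>\<^sub>F q in sequentially. \<exists>\<mu>\<in>fps_supp G. q ^ 3 \<le> \<mu> \<and> \<mu> \<le> q ^ 8"
  defines "H \<equiv> fps_bipoly I c e F G"
  shows "\<forall>\<^sub>F q in sequentially. \<exists>z \<le> 3 * q ^ 16. fps_nth H z > 0 \<and>
     (\<forall>n<z. z \<le> n + q \<longrightarrow> fps_nth H n = 0) \<and> (\<forall>n. z < n \<longrightarrow> n \<le> z + q \<longrightarrow> fps_nth H n \<ge> 0)"
proof -
  define E where "E = Max (e ` I)"
  define J where "J = Max (snd ` I)"
  have E: "e p \<le> E" if "p \<in> I" for p using that I unfolding E_def by auto
  have J: "j \<le> J" if "(i, j) \<in> I" for i j
  proof -
    have "j \<in> snd ` I" using that by force
    then show ?thesis using I unfolding J_def by auto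
  qed
  define T where "T = fps_supp (F ^ k * G ^ l)"
  \<comment> \<open>\<open>L1\<close> contains the supports of all terms with \<open>i < k\<close>,
    and \<open>L2\<close> those of the terms with \<open>i = k\<close> and \<open>j < l\<close>. For
    \<open>k = 0\<close> or \<open>l = 0\<close> the truncated exponents mean nothing, hence the
    guards \<open>k > 0\<close> and \<open>l > 0\<close> below.\<close>
  define L1 where "L1 = fps_supp (F ^ (k - 1) * G ^ J)"
  define L2 where "L2 = fps_supp (F ^ k * G ^ (l - 1))"
  have nnp: "nonneg_fps (F ^ i * G ^ j)" for i j
    by (intro nonneg_fps_mult nonneg_fps_power nn)
  have isol': "\<forall>\<^sub>F q in sequentially. \<exists>s\<in>fps_supp (F ^ k). s \<le> q ^ 16 \<and>
        (k > 0 \<longrightarrow> (\<forall>t\<in>L1. t + q ^ 12 < s \<or> s + q ^ 12 < t))"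
  proof (cases "k > 0")
    case True
    from isol[OF this, of J] show ?thesis by eventually_elim (auto simp: L1_def)
  next
    case False
    then show ?thesis by (intro always_eventually allI bexI[of _ 0]) (auto simp: fps_supp_def)
  qed
  have sub1: "m \<in> L1" if "(i, j) \<in> I" "i < k" "m \<in> fps_supp (F ^ i * G ^ j)" for i j m
  proof -
    have "fps_supp (F ^ i * G ^ j) \<subseteq> L1" unfolding L1_def
      using that J by (intro fps_supp_mult_mono fps_supp_power_Suc_mono nonneg_fps_power nn z) auto
    then show ?thesis using that by blast
  qed
  have sub2: "m \<in> L2" if "j < l" "m \<in> fps_supp (F ^ k * G ^ j)" for j m
  proof -
    have "fps_supp (F ^ k * G ^ j) \<subseteq> L2" unfolding L2_def
      using that by (intro fps_supp_mult_mono fps_supp_power_Suc_mono nonneg_fps_power nn z) auto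
    then show ?thesis using that by blast
  qed
  show ?thesis
    using sparse[of k l] sparse[of k "l - 1"] isol' dense eventually_ge_at_top[of "E + 4"]
  proof eventually_elim
    case (elim q)
    have q: "q \<ge> E + 4" by fact
    \<comment> \<open>Distinct powers of \<open>q\<close> differ by a factor of at least 4, which
      settles every comparison of scales below.\<close>
    have q4: "4 * q ^ a \<le> q ^ b" if "a < b" for a b :: nat
    proof -
      have "4 * q ^ a \<le> q * q ^ a" using q by (intro mult_right_mono) auto
      also have "\<dots> = q ^ Suc a" by simp
      also have "\<dots> \<le> q ^ b" using that q by (intro power_increasing) auto
      finally show ?thesis .
    qed
    have pows: "q + E \<le> 2 * q" "4 * q \<le> q ^ 2" "4 * q ^ 2 \<le> q ^ 3" "4 * q ^ 3 \<le> q ^ 8" "4 * q ^ 8 \<le> q ^ 9"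
        "4 * q ^ 9 \<le> q ^ 10" "4 * q ^ 10 \<le> q ^ 12" "4 * q ^ 12 \<le> q ^ 16"
      using q q4[of 1 2] q4[of 2 3] q4[of 3 8] q4[of 8 9] q4[of 9 10] q4[of 10 12] q4[of 12 16] by auto
    obtain s where s: "s \<in> fps_supp (F ^ k)" "s \<le> q ^ 16"
      "k > 0 \<Longrightarrow> \<forall>t\<in>L1. t + q ^ 12 < s \<or> s + q ^ 12 < t" using elim(3) by blast
    \<comment> \<open>The margin \<open>q ^ 2 + 2 * q + E\<close> around \<open>t0\<close> covers
      the later move to the left, the window of radius \<open>q\<close> and the shifts
      \<open>e p\<close>.\<close>
    have "\<exists>t0\<in>T. s \<le> t0 \<and> t0 \<le> s + q ^ 10 + q ^ 8 \<and>
       (\<forall>n. l > 0 \<longrightarrow> n + q ^ 2 + 2 * q + E \<ge> t0 \<longrightarrow> n \<le> t0 + q ^ 2 + 2 * q + E \<longrightarrow> n \<notin> L2)"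
    proof (cases "l = 0")
      case True
      then show ?thesis using s(1) by (intro bexI[of _ s]) (auto simp: T_def)
    next
      case False
      have "s + 0 \<in> L2" unfolding L2_def
        by (intro fps_supp_multI nonneg_fps_power nn s zero_in_fps_supp_power z)
      then have sL2: "s \<in> L2" by simp
      have q10: "q * q ^ 9 = q ^ 10" by (simp flip: power_Suc)
      have "L2 \<inter> {s..s + q * q ^ 9} \<subseteq> L2 \<inter> {..<3 * q ^ 16}"
        unfolding q10 using s(2) pows q by auto
      then have "card (L2 \<inter> {s..s + q * q ^ 9}) \<le> q"
        using elim(2) unfolding L2_def by (meson card_mono finite_Int finite_lessThan order.trans)
      \<comment> \<open>\<open>y\<close> is followed by a gap of \<open>L2\<close> of length
        \<open>q ^ 9\<close>. One more factor \<open>G\<close> adds \<open>\<mu>\<close>, between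
        \<open>q ^ 3\<close> and \<open>q ^ 8\<close>, which lands well inside this gap.\<close>
      from gap_to_the_right[OF sL2 this] obtain y
        where y: "y \<in> L2" "s \<le> y" "y \<le> s + q * q ^ 9" "L2 \<inter> {y<..y + q ^ 9} = {}" by blast
      obtain \<mu> where \<mu>: "\<mu> \<in> fps_supp G" "q ^ 3 \<le> \<mu>" "\<mu> \<le> q ^ 8" using elim(4) by blast
      have "y + \<mu> \<in> fps_supp ((F ^ k * G ^ (l - 1)) * G)"
        using y(1) \<mu>(1) unfolding L2_def by (intro fps_supp_multI nnp nn)
      moreover have "(F ^ k * G ^ (l - 1)) * G = F ^ k * G ^ l"
        using False by (cases l) (auto simp: mult_ac)
      ultimately have T: "y + \<mu> \<in> T" unfolding T_def by metis
      have "n \<notin> L2" if "n + q ^ 2 + 2 * q + E \<ge> y + \<mu>" "n \<le> y + \<mu> + q ^ 2 + 2 * q + E" for n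
      proof -
        have "n > y" using that(1) \<mu>(2) pows q by linarith
        moreover have "n \<le> y + q ^ 9" using that(2) \<mu>(3) pows q by linarith
        ultimately show ?thesis using y(4) by auto
      qed
      then show ?thesis using T y(2,3) \<mu>(3) unfolding q10 by (intro bexI[of _ "y + \<mu>"]) auto
    qed
    then obtain t0 where t0: "t0 \<in> T" "s \<le> t0" "t0 \<le> s + q ^ 10 + q ^ 8"
      "\<And>n. l > 0 \<Longrightarrow> n + q ^ 2 + 2 * q + E \<ge> t0 \<Longrightarrow> n \<le> t0 + q ^ 2 + 2 * q + E \<Longrightarrow> n \<notin> L2" by blast
    have "T \<inter> {..t0} \<subseteq> T \<inter> {..<3 * q ^ 16}" using t0(3) s(2) pows q by auto
    then have "card (T \<inter> {..t0}) \<le> q"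
      using elim(1) unfolding T_def by (meson card_mono finite_Int finite_lessThan order.trans)
    \<comment> \<open>A move inside \<open>T\<close> by at most \<open>q * q\<close> frees the
      \<open>q\<close> places before \<open>t\<close>; the margins around \<open>t0\<close> allow
      for it.\<close>
    from gap_to_the_left[OF t0(1) this, of q] obtain t
      where t: "t \<in> T" "t \<le> t0" "t0 \<le> t + q * q" "\<And>n. n \<in> T \<Longrightarrow> n < t \<Longrightarrow> n + q < t" by blast
    \<comment> \<open>Within distance \<open>q\<close> of \<open>t + e (k, l)\<close> all other
      terms vanish, so \<open>H\<close> inherits its signs there from the leading term.\<close>
    have main: "fps_nth H n = of_int (c (k, l)) * (if n < e (k, l) then 0 else fps_nth (F ^ k * G ^ l) (n - e (k, l)))"
      if n: "t + e (k, l) \<le> n + q" "n \<le> t + e (k, l) + q" for n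
    proof -
      have zero: "(if n < e p then 0 else fps_nth (F ^ fst p * G ^ snd p) (n - e p)) = 0"
        if p: "p \<in> I - {(k, l)}" for p
      proof (rule ccontr)
        assume nz: "\<not> ?thesis"
        obtain i j where ij: "p = (i, j)" by force
        define m where "m = n - e p"
        have m: "n = m + e p" "m \<in> fps_supp (F ^ i * G ^ j)"
          using nz ij by (auto simp: fps_supp_def m_def split: if_splits)
        have eE: "e p \<le> E" "e (k, l) \<le> E" using E p I by auto
        have lo: "t0 \<le> m + q ^ 2 + 2 * q + E" using n(1) t(3) m(1) eE by (simp add: power2_eq_square)
        have up: "m \<le> t0 + q ^ 2 + 2 * q + E" using n(2) t(2) m(1) eE by linarith
        consider "i < k" | "i = k" "j < l" using lex[of i j] p ij by fastforce
        then show False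
        proof cases
          case 1
          then have "m \<in> L1" using sub1 m(2) p ij by blast
          then have "m + q ^ 12 < s \<or> s + q ^ 12 < m" using s(3) 1 by auto
          then show False using lo up t0(2,3) pows q by linarith
        next
          case 2
          then have "m \<in> L2" using sub2 m(2) by blast
          then show False using t0(4)[OF _ lo up] 2 by auto
        qed
      qed
      have "fps_nth H n = (\<Sum>p\<in>{(k, l)}. of_int (c p) * (if n < e p then 0 else fps_nth (F ^ fst p * G ^ snd p) (n - e p)))"
        unfolding H_def fps_nth_bipoly
        by (rule sum.mono_neutral_right) (use I zero in auto)
      then show ?thesis by simp
    qed
    show ?case
    proof (intro exI[of _ "t + e (k, l)"] conjI allI impI)
      show "t + e (k, l) \<le> 3 * q ^ 16" using t(2) t0(3) s(2) E[OF I(2)] pows q by linarith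
      have "fps_nth (F ^ k * G ^ l) t > 0"
        using t(1) nnp[of k l] by (simp add: T_def fps_supp_def nonneg_fps_def less_le)
      then show "fps_nth H (t + e (k, l)) > 0" using main[of "t + e (k, l)"] I(3) by simp
    next
      fix n assume n: "n < t + e (k, l)" "t + e (k, l) \<le> n + q"
      have "fps_nth (F ^ k * G ^ l) (n - e (k, l)) = 0" if "\<not> n < e (k, l)"
        using t(4)[of "n - e (k, l)"] n that unfolding T_def fps_supp_def by fastforce
      then show "fps_nth H n = 0" using main[of n] n by auto
    next
      fix n assume n: "t + e (k, l) < n" "n \<le> t + e (k, l) + q"
      then show "fps_nth H n \<ge> 0" using main[of n] I(3) nnp[of k l] by (simp add: nonneg_fps_def)
    qed
  qed
qed

section \<open>Growth of the exponents\<close>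

lemma ultimate_inverseE:
  assumes "ultimate_inverse R0 f g"
  obtains R1 where "R1 \<ge> R0" "strict_mono_on {R1..} f"
    "\<And>x. x \<ge> f R1 \<Longrightarrow> g x \<ge> R1 \<and> f (g x) = x" "\<And>R. R \<ge> R1 \<Longrightarrow> f R \<ge> f R1 \<and> g (f R) = R"
proof -
  obtain R1 where R1: "R1 \<ge> R0" "strict_mono_on {R1..} f" "bij_betw f {R1..} {f R1..}"
    "\<forall>x\<ge>f R1. g x = inv_into {R1..} f x"
    using assms unfolding ultimate_inverse_def by blast
  have surj: "f ` {R1..} = {f R1..}" and inj: "inj_on f {R1..}" using R1(3) by (auto simp: bij_betw_def)
  show ?thesis
  proof (rule that[of R1])
    fix x assume x: "x \<ge> f R1"
    then have "x \<in> f ` {R1..}" using surj by auto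
    then show "g x \<ge> R1 \<and> f (g x) = x"
      using R1(4) x inv_into_into[of x f "{R1..}"] f_inv_into_f[of x f "{R1..}"] by auto
  next
    fix R assume R: "R \<ge> R1"
    then have "f R \<in> {f R1..}" using surj by blast
    then show "f R \<ge> f R1 \<and> g (f R) = R" using R1(4) R inv_into_f_f[OF inj] by auto
  qed (use R1 in auto)
qed

text \<open>Surjectivity onto the ray \<open>{f R1..}\<close> makes \<open>f\<close> unbounded;
  monotonicity makes \<open>g\<close> exceed \<open>Z\<close> from \<open>f (max R1 Z)\<close>
  on.\<close>

lemma ultimate_inverse_at_top:
  assumes "ultimate_inverse R0 f g"
  shows "filterlim f at_top at_top" "filterlim g at_top at_top"
proof -
  obtain R1 where R1: "R1 \<ge> R0" "strict_mono_on {R1..} f"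
    "\<And>x. x \<ge> f R1 \<Longrightarrow> g x \<ge> R1 \<and> f (g x) = x" "\<And>R. R \<ge> R1 \<Longrightarrow> f R \<ge> f R1 \<and> g (f R) = R"
    using assms by (rule ultimate_inverseE) (rule that)
  have mono: "f x \<le> f y" if "R1 \<le> x" "x \<le> y" for x y
    using strict_mono_on_leD[OF R1(2)] that by auto
  show "filterlim f at_top at_top" unfolding filterlim_at_top eventually_at_top_linorder
  proof
    fix Z
    show "\<exists>N. \<forall>n\<ge>N. Z \<le> f n"
    proof (intro exI[of _ "g (max Z (f R1))"] allI impI)
      fix n assume "g (max Z (f R1)) \<le> n"
      then show "Z \<le> f n" using R1(3)[of "max Z (f R1)"] mono[of "g (max Z (f R1))" n] by auto
    qed
  qed
  show "filterlim g at_top at_top" unfolding filterlim_at_top eventually_at_top_linorder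
  proof
    fix Z
    show "\<exists>N. \<forall>x\<ge>N. Z \<le> g x"
    proof (intro exI[of _ "f (max R1 Z)"] allI impI)
      fix x assume x: "f (max R1 Z) \<le> x"
      then have "x \<ge> f R1" using mono[of R1 "max R1 Z"] by auto
      then have gx: "g x \<ge> R1" "f (g x) = x" using R1(3) by auto
      show "Z \<le> g x"
      proof (rule ccontr)
        assume "\<not> Z \<le> g x"
        then have "f (g x) < f (max R1 Z)" using strict_mono_onD[OF R1(2), of "g x" "max R1 Z"] gx by auto
        then show False using gx x by simp
      qed
    qed
  qed
qed

lemma ultimate_inverse_eventually:
  assumes "ultimate_inverse R0 f g"
  shows "\<forall>\<^sub>F x in at_top. f (g x) = x" "\<forall>\<^sub>F x in at_top. \<forall>y\<ge>x. g x \<le> g y"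
proof -
  obtain R1 where R1: "R1 \<ge> R0" "strict_mono_on {R1..} f"
    "\<And>x. x \<ge> f R1 \<Longrightarrow> g x \<ge> R1 \<and> f (g x) = x" "\<And>R. R \<ge> R1 \<Longrightarrow> f R \<ge> f R1 \<and> g (f R) = R"
    using assms by (rule ultimate_inverseE) (rule that)
  show "\<forall>\<^sub>F x in at_top. f (g x) = x"
    using eventually_ge_at_top[of "f R1"] by eventually_elim (use R1(3) in auto)
  show "\<forall>\<^sub>F x in at_top. \<forall>y\<ge>x. g x \<le> g y"
    using eventually_ge_at_top[of "f R1"]
  proof eventually_elim
    case (elim x)
    show ?case
    proof (intro allI impI)
      fix y assume y: "y \<ge> x"
      have "g x \<ge> R1 \<and> f (g x) = x" "g y \<ge> R1 \<and> f (g y) = y" using R1(3) y elim by auto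
      then show "g x \<le> g y"
        using strict_mono_onD[OF R1(2), of "g y" "g x"] y by (auto simp: not_le[symmetric] intro: ccontr)
    qed
  qed
qed

section \<open>The rapidly growing function\<close>

locale fast_growth =
  fixes m0 :: nat and a b :: "real \<Rightarrow> real"
  assumes inverse: "ultimate_inverse (real m0) a b"
    and incr: "ultimately_increasing (\<lambda>R::real. ln (a R) / ln R)"
    and lim: "filterlim (\<lambda>R::real. ln (a R) / ln R) at_top at_top"
    and diff: "a differentiable_on {real m0..}"
    and deriv_bound: "\<forall>\<epsilon>>0. \<exists>C>0. \<forall>R\<ge>C. deriv (\<lambda>x. ln (a x)) R < R powr (-1 + \<epsilon>)"
begin

lemma b_at_top: "filterlim b at_top at_top" and a_at_top: "filterlim a at_top at_top"
  using ultimate_inverse_at_top[OF inverse] by auto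

lemma eventually_b_ge: "\<forall>\<^sub>F x in at_top. b x \<ge> Z"
  using b_at_top by (auto simp: filterlim_at_top)

text \<open>At \<open>R = b x\<close> the quotient in \<open>lim\<close> is
  \<open>ln x / ln (b x)\<close>, and its divergence pushes \<open>b\<close> below every positive
  power.\<close>

lemma b_le_powr:
  assumes "\<epsilon> > 0"
  shows "\<forall>\<^sub>F x in at_top. b x \<le> x powr \<epsilon>"
proof -
  have "filterlim (\<lambda>x. ln (a (b x)) / ln (b x)) at_top at_top"
    by (rule filterlim_compose[OF lim b_at_top])
  then have "\<forall>\<^sub>F x in at_top. ln (a (b x)) / ln (b x) \<ge> 1 / \<epsilon>" by (auto simp: filterlim_at_top)
  then show ?thesis
    using ultimate_inverse_eventually(1)[OF inverse] eventually_b_ge[of 2] eventually_gt_at_top[of 1]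
  proof eventually_elim
    case (elim x)
    have "ln (b x) > 0" using elim by simp
    then have "ln (b x) \<le> \<epsilon> * ln x" using elim assms by (simp add: field_simps)
    then have "exp (ln (b x)) \<le> exp (\<epsilon> * ln x)" by simp
    then show ?case using elim by (simp add: powr_def)
  qed
qed

text \<open>The monotone quotient of \<open>incr\<close>, read at \<open>R = b x\<close>, shows that
  \<open>ln (b x) / ln x\<close> does not increase. This compares the values of \<open>b\<close> at
  different scales.\<close>

lemma ln_b_ratio:
  "\<forall>\<^sub>F x in at_top. \<forall>y\<ge>x. ln (b y) * ln x \<le> ln (b x) * ln y"
proof -
  obtain R2 where R2: "strict_mono_on {R2..} (\<lambda>R::real. ln (a R) / ln R)"
    using incr unfolding ultimately_increasing_def by blast
  have "\<forall>\<^sub>F x in at_top. \<forall>y\<ge>x. a (b y) = y"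
    using ultimate_inverse_eventually(1)[OF inverse] by (rule eventually_all_ge_at_top)
  then show ?thesis
    using ultimate_inverse_eventually(2)[OF inverse] eventually_b_ge[of "max R2 2"]
  proof eventually_elim
    case (elim x)
    show ?case
    proof (intro allI impI)
      fix y assume y: "y \<ge> x"
      have le: "b x \<le> b y" using elim y by auto
      have "ln (a (b x)) / ln (b x) \<le> ln (a (b y)) / ln (b y)"
        using strict_mono_on_leD[OF R2, of "b x" "b y"] le elim by auto
      moreover have "ln (b x) > 0" "ln (b y) > 0" using elim le by auto
      ultimately show "ln (b y) * ln x \<le> ln (b x) * ln y" using elim y by (simp add: field_simps)
    qed
  qed
qed

text \<open>For the integer part \<open>m\<close> of \<open>b x\<close>, the mean value theorem for
  \<open>ln a\<close> on an interval of length below 1 bounds \<open>ln x - ln (a m)\<close> by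
  \<open>m powr (-1 + \<epsilon> / 2)\<close>, which becomes a relative error after exponentiation.
  The half of \<epsilon> kept back pays for replacing \<open>m\<close> by
  \<open>b x\<close>.\<close>

lemma greedy_approximation:
  assumes "0 < \<epsilon>" "\<epsilon> < 1"
  shows "\<forall>\<^sub>F x in at_top. \<exists>m\<ge>m0. a (real m) \<le> x \<and> x - a (real m) \<le> x * b x powr (-1 + \<epsilon>)"
proof -
  obtain R1 where R1: "R1 \<ge> real m0" "strict_mono_on {R1..} a"
    using inverse by (rule ultimate_inverseE) (rule that)
  obtain C where C: "\<forall>R\<ge>C. deriv (\<lambda>x. ln (a x)) R < R powr (-1 + \<epsilon> / 2)"
    using deriv_bound assms(1) half_gt_zero by metis
  have "\<forall>\<^sub>F R in at_top. a R \<ge> 1" using a_at_top by (auto simp: filterlim_at_top)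
  then obtain R3 where R3: "\<And>R. R \<ge> R3 \<Longrightarrow> a R \<ge> 1" by (auto simp: eventually_at_top_linorder)
  \<comment> \<open>The margin keeps the integer part of \<open>b x\<close> past every threshold and
    strictly beyond \<open>m0\<close>, where differentiability on the closed ray becomes
    two-sided.\<close>
  define R4 where "R4 = \<bar>R1\<bar> + \<bar>C\<bar> + \<bar>R3\<bar> + real m0 + 4"
  have pw: "\<forall>\<^sub>F t::real in at_top. 2 \<le> t powr (\<epsilon> / 2)"
    using assms by real_asymp
  have "\<forall>\<^sub>F x in at_top. 2 \<le> b x powr (\<epsilon> / 2)"
    by (rule eventually_compose_filterlim[OF pw b_at_top])
  then show ?thesis
    using eventually_b_ge[of R4] ultimate_inverse_eventually(1)[OF inverse] eventually_ge_at_top[of 1]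
  proof eventually_elim
    case (elim x)
    define m where "m = nat \<lfloor>b x\<rfloor>"
    define t where "t = real m"
    have t: "t \<le> b x" "b x < t + 1" "t \<ge> R4 - 1" using elim unfolding m_def t_def R4_def by linarith+
    then have t': "t \<ge> R1" "t \<ge> C" "t \<ge> R3" "t > real m0" "t \<ge> b x / 2" "t > 0"
      using elim unfolding R4_def by linarith+
    have apos: "a r \<ge> 1" if "r \<ge> t" for r using R3 t' that by auto
    have adiff: "a differentiable (at r)" if "r \<ge> t" for r
    proof -
      have "a differentiable (at r within {real m0..})"
        using diff t' that by (auto simp: differentiable_on_def)
      then have "a differentiable (at r within {real m0<..})"
        by (rule differentiable_within_subset) auto
      moreover have "at r within {real m0<..} = at r"
        by (rule at_within_open) (use t' that in auto)
      ultimately show ?thesis by simp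
    qed
    \<comment> \<open>As \<open>a\<close> is differentiable and positive here, \<open>deriv\<close>
      is a genuine derivative and can enter the mean value theorem.\<close>
    have lnderiv: "((\<lambda>x. ln (a x)) has_real_derivative deriv (\<lambda>x. ln (a x)) r) (at r)" if r: "r \<ge> t" for r
    proof -
      obtain D where "(a has_real_derivative D) (at r)"
        using adiff[OF r] by (auto simp: real_differentiable_def)
      then have "((\<lambda>x. ln (a x)) has_real_derivative (D / a r)) (at r)"
        using apos[OF r] by (auto intro!: derivative_eq_intros)
      then show ?thesis using DERIV_imp_deriv by metis
    qed
    have am: "a t \<le> x"
      using strict_mono_on_leD[OF R1(2), of t "b x"] t t' elim by auto
    define \<delta> where "\<delta> = t powr (-1 + \<epsilon> / 2)"
    have "\<delta> \<ge> 0" by (simp add: \<delta>_def)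
    have "ln x - ln (a t) \<le> \<delta>"
    proof (cases "t = b x")
      case True
      then show ?thesis using elim \<open>\<delta> \<ge> 0\<close> by simp
    next
      case False
      then have lt: "t < b x" using t by simp
      obtain \<xi> where \<xi>: "t < \<xi>" "\<xi> < b x" "ln (a (b x)) - ln (a t) = (b x - t) * deriv (\<lambda>x. ln (a x)) \<xi>"
        using MVT2[OF lt, of "\<lambda>x. ln (a x)" "deriv (\<lambda>x. ln (a x))"] lnderiv by auto
      have "deriv (\<lambda>x. ln (a x)) \<xi> \<le> \<xi> powr (-1 + \<epsilon> / 2)" using C \<xi> t' by (intro less_imp_le) auto
      also have "\<dots> \<le> \<delta>" unfolding \<delta>_def using \<xi> t' assms by (intro powr_mono2') auto
      finally have "(b x - t) * deriv (\<lambda>x. ln (a x)) \<xi> \<le> (b x - t) * \<delta>" using lt by (intro mult_left_mono) auto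
      also have "\<dots> \<le> 1 * \<delta>" using t \<open>\<delta> \<ge> 0\<close> by (intro mult_right_mono) auto
      finally show ?thesis using \<xi>(3) elim by simp
    qed
    then have "ln x - \<delta> \<le> ln (a t)" by simp
    then have "exp (ln x - \<delta>) \<le> exp (ln (a t))" by simp
    then have "x * exp (- \<delta>) \<le> a t" using elim apos[of t] by (simp add: exp_diff exp_minus field_simps)
    moreover have "x * (1 - \<delta>) \<le> x * exp (- \<delta>)" using elim exp_ge_add_one_self[of "-\<delta>"] by (intro mult_left_mono) auto
    ultimately have "x - a t \<le> x * \<delta>" by (simp add: algebra_simps)
    also have "\<dots> \<le> x * b x powr (-1 + \<epsilon>)"
    proof (rule mult_left_mono)
      have bx: "b x > 0" using t t' by linarith
      have "\<delta> \<le> (b x / 2) powr (-1 + \<epsilon> / 2)" unfolding \<delta>_def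
        using t' assms bx by (intro powr_mono2') auto
      also have "\<dots> = b x powr (-1 + \<epsilon> / 2) * 2 powr (1 - \<epsilon> / 2)"
        using bx powr_minus_divide[of 2 "-1 + \<epsilon> / 2"] by (simp add: powr_divide)
      also have "\<dots> \<le> b x powr (-1 + \<epsilon> / 2) * 2 powr 1"
        using assms by (intro mult_left_mono powr_mono) auto
      also have "\<dots> \<le> b x powr (-1 + \<epsilon> / 2) * b x powr (\<epsilon> / 2)"
        using elim by (intro mult_left_mono) auto
      also have "\<dots> = b x powr (-1 + \<epsilon>)" by (simp flip: powr_add)
      finally show "\<delta> \<le> b x powr (-1 + \<epsilon>)" .
    qed (use elim in auto)
    finally show ?case using am t' unfolding t_def by (intro exI[of _ m]) auto
  qed
qed

end

section \<open>The slowly growing function\<close>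

text \<open>The integer part \<open>m\<close> of \<open>v y\<close> works, since
  \<open>u m \<le> y \<le> u (m + 1) < C * u m\<close>.\<close>

lemma slow_growth_window:
  assumes inv: "ultimate_inverse (real m0) u v"
    and ratio: "\<forall>\<^sub>F R in at_top. u (R + 1) / u R < C"
  shows "\<forall>\<^sub>F y in at_top. \<exists>m\<ge>m0. y \<le> C * u (real m) \<and> u (real m) \<le> y"
proof -
  obtain R1 where R1: "R1 \<ge> real m0" "strict_mono_on {R1..} u"
    using inv by (rule ultimate_inverseE) (rule that)
  have "\<forall>\<^sub>F R in at_top. u R \<ge> 1" using ultimate_inverse_at_top(1)[OF inv] by (auto simp: filterlim_at_top)
  with ratio have "\<forall>\<^sub>F R in at_top. u (R + 1) / u R < C \<and> u R \<ge> 1" by (rule eventually_conj)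
  then obtain R2 where R2: "\<And>R. R \<ge> R2 \<Longrightarrow> u (R + 1) / u R < C \<and> u R \<ge> 1"
    by (auto simp: eventually_at_top_linorder)
  have "\<forall>\<^sub>F y in at_top. v y \<ge> \<bar>R1\<bar> + \<bar>R2\<bar> + 2"
    using ultimate_inverse_at_top(2)[OF inv] by (auto simp: filterlim_at_top)
  then show ?thesis using ultimate_inverse_eventually(1)[OF inv]
  proof eventually_elim
    case (elim y)
    define m where "m = nat \<lfloor>v y\<rfloor>"
    have m: "real m \<le> v y" "v y < real m + 1" using elim unfolding m_def by linarith+
    have m': "real m \<ge> R1" "real m \<ge> R2" using m elim by linarith+
    have "u (real m) \<le> u (v y)" "u (v y) \<le> u (real m + 1)"
      using strict_mono_on_leD[OF R1(2)] m m' by auto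
    moreover have "u (real m + 1) < C * u (real m)" using R2[OF m'(2)] pos_divide_less_eq[of "u (real m)"] by auto
    ultimately show ?case using elim m' R1(1) by (intro exI[of _ m]) auto
  qed
qed

section \<open>Power series with prescribed exponents\<close>

text \<open>Finitely many early exponents may repeat, so they enter as separate monomials counted
  with multiplicity; the later, distinct ones give a series with coefficients 0 and 1.\<close>

lemma exponent_series:
  fixes \<alpha> :: "nat \<Rightarrow> nat"
  assumes "strict_mono_on {M..} \<alpha>"
  obtains F where "digit_series F" "nonneg_fps F" "fps_supp F = range \<alpha>"
    "\<And>x. \<bar>x\<bar> < 1 \<Longrightarrow> (\<lambda>m. x ^ \<alpha> m) sums eval_fps F x"
proof
  define F2 :: "real fps" where "F2 = Abs_fps (\<lambda>n. if n \<in> \<alpha> ` {M..} then 1 else 0)"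
  define F where "F = (\<Sum>m<M. fps_X ^ \<alpha> m) + F2"
  have F2: "digit_series F2"
    by (rule digit_series_bounded[of _ 1]) (auto simp: F2_def)
  show dF: "digit_series F" unfolding F_def
    by (intro digit_series_add digit_series_sum digit_series_X_power F2)
  have nth: "fps_nth F n = (\<Sum>m<M. if n = \<alpha> m then 1 else 0) + (if n \<in> \<alpha> ` {M..} then 1 else 0)" for n
    by (simp add: F_def F2_def fps_sum_nth fps_X_power_nth)
  show "nonneg_fps F" unfolding nonneg_fps_def nth by (intro allI add_nonneg_nonneg sum_nonneg) simp_all
  show "fps_supp F = range \<alpha>"
  proof -
    have "fps_nth F n \<noteq> 0 \<longleftrightarrow> n \<in> range \<alpha>" for n
    proof
      assume "fps_nth F n \<noteq> 0"
      then have "(\<Sum>m<M. if n = \<alpha> m then 1 else 0 :: real) \<noteq> 0 \<or> n \<in> \<alpha> ` {M..}"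
        unfolding nth by (cases "n \<in> \<alpha> ` {M..}") simp_all
      then show "n \<in> range \<alpha>"
        by (auto elim!: sum.not_neutral_contains_not_neutral split: if_splits)
    next
      assume "n \<in> range \<alpha>"
      then obtain m where m: "n = \<alpha> m" by auto
      show "fps_nth F n \<noteq> 0"
      proof (cases "m < M")
        case True
        have "(1::real) \<le> (\<Sum>m<M. if n = \<alpha> m then 1 else 0)"
          using member_le_sum[of m "{..<M}" "\<lambda>m. if n = \<alpha> m then (1::real) else 0"] True m by simp
        then show ?thesis unfolding nth by auto
      next
        case False
        have "(0::real) \<le> (\<Sum>m<M. if n = \<alpha> m then 1 else 0)" by (intro sum_nonneg) auto
        moreover have "n \<in> \<alpha> ` {M..}" using False m by auto
        ultimately show ?thesis unfolding nth by simp
      qed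
    qed
    then show ?thesis by (auto simp: fps_supp_def)
  qed
  fix x :: real assume x: "\<bar>x\<bar> < 1"
  \<comment> \<open>The strictly increasing \<open>g\<close> reindexes the sum over all powers of
    \<open>x\<close> as a sum over \<open>m\<close>.\<close>
  define g where "g = (\<lambda>m. \<alpha> (m + M))"
  have g: "strict_mono g"
    using assms by (auto simp: g_def strict_mono_def strict_mono_on_def)
  have rg: "range g = \<alpha> ` {M..}"
  proof (intro equalityI subsetI)
    fix y assume "y \<in> \<alpha> ` {M..}"
    then obtain n where "n \<ge> M" "y = \<alpha> n" by auto
    then show "y \<in> range g" by (intro image_eqI[of _ _ "n - M"]) (auto simp: g_def)
  qed (auto simp: g_def)
  have "(\<lambda>n. fps_nth F2 n * x ^ n) sums eval_fps F2 x"
    unfolding eval_fps_def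
    by (intro summable_sums summable_fps digit_series_conv_radius F2) (use x in auto)
  then have "(\<lambda>m. fps_nth F2 (g m) * x ^ g m) sums eval_fps F2 x"
    by (subst sums_mono_reindex[OF g]) (auto simp: F2_def rg)
  moreover have "fps_nth F2 (g m) = 1" for m using rg by (auto simp: F2_def)
  ultimately have "(\<lambda>m. x ^ \<alpha> (m + M)) sums eval_fps F2 x" by (simp add: g_def)
  then have 1: "(\<lambda>m. x ^ \<alpha> m) sums (eval_fps F2 x + (\<Sum>m<M. x ^ \<alpha> m))"
    by (subst (asm) sums_iff_shift)
  have "(\<lambda>n. (\<Sum>m<M. (if n = \<alpha> m then 1 else 0) * x ^ n) + fps_nth F2 n * x ^ n) sums ((\<Sum>m<M. x ^ \<alpha> m) + eval_fps F2 x)"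
  proof (intro sums_add sums_sum)
    fix m
    have "(\<lambda>n. if n = \<alpha> m then x ^ n else 0) sums x ^ \<alpha> m" by (rule sums_single)
    then show "(\<lambda>n. (if n = \<alpha> m then 1 else 0) * x ^ n) sums x ^ \<alpha> m"
      by (rule sums_cong[THEN iffD1, rotated]) auto
  qed fact
  moreover have "(\<Sum>m<M. (if n = \<alpha> m then 1 else 0) * x ^ n) + fps_nth F2 n * x ^ n = fps_nth F n * x ^ n" for n
    unfolding nth by (simp add: F2_def sum_distrib_right distrib_right)
  ultimately have "(\<lambda>n. fps_nth F n * x ^ n) sums ((\<Sum>m<M. x ^ \<alpha> m) + eval_fps F2 x)" by simp
  then have "eval_fps F x = (\<Sum>m<M. x ^ \<alpha> m) + eval_fps F2 x"
    by (simp add: eval_fps_def sums_iff)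
  with 1 show "(\<lambda>m. x ^ \<alpha> m) sums eval_fps F x" by (simp add: add.commute)
qed

lemma eventually_real_plus:
  assumes "\<forall>\<^sub>F y in at_top. P (y::real)"
  shows "\<forall>\<^sub>F N in sequentially. P (real N + c)"
proof -
  have "filterlim (\<lambda>N. real N + c) at_top sequentially" by real_asymp
  with assms show ?thesis by (rule eventually_compose_filterlim)
qed

text \<open>\<open>\<alpha> m < N\<close> means \<open>a (m0 + m) < N + K\<close>, and the inverse
  function then bounds the index by \<open>b (N + K)\<close>.\<close>

lemma card_exponents_le:
  assumes inv: "ultimate_inverse (real m0) a b"
    and \<alpha>: "\<And>m. int (\<alpha> m) = \<lfloor>a (real (m0 + m))\<rfloor> - K"
  shows "\<forall>\<^sub>F N in sequentially. real (card (range \<alpha> \<inter> {..<N})) \<le> b (real N + of_int K) + 1"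
proof -
  obtain R1 where R1: "R1 \<ge> real m0" "strict_mono_on {R1..} a"
    "\<And>x. x \<ge> a R1 \<Longrightarrow> b x \<ge> R1 \<and> a (b x) = x"
    using inv by (rule ultimate_inverseE) (rule that)
  have "\<forall>\<^sub>F y in at_top. y \<ge> a R1" by (rule eventually_ge_at_top)
  then have "\<forall>\<^sub>F N in sequentially. real N + of_int K \<ge> a R1" by (rule eventually_real_plus)
  then show ?thesis
  proof eventually_elim
    case (elim N)
    let ?y = "real N + of_int K"
    have b: "b ?y \<ge> R1" "a (b ?y) = ?y" using R1(3)[OF elim] by auto
    have "m < nat \<lceil>b ?y\<rceil>" if "\<alpha> m < N" for m
    proof -
      have "\<lfloor>a (real (m0 + m))\<rfloor> < int N + K" using \<alpha>[of m] that by linarith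
      then have lt: "a (real (m0 + m)) < ?y" by linarith
      \<comment> \<open>An index at or beyond \<open>b ?y\<close> would lie on the ray from
        \<open>R1\<close>, where \<open>a\<close> is known to be monotone.\<close>
      have "real (m0 + m) < b ?y"
      proof (rule ccontr)
        assume "\<not> ?thesis"
        then have "a (b ?y) \<le> a (real (m0 + m))"
          using strict_mono_on_leD[OF R1(2), of "b ?y" "real (m0 + m)"] b(1) by auto
        then show False using lt b by simp
      qed
      then show ?thesis by linarith
    qed
    then have "range \<alpha> \<inter> {..<N} \<subseteq> \<alpha> ` {..<nat \<lceil>b ?y\<rceil>}" by auto
    then have "card (range \<alpha> \<inter> {..<N}) \<le> card (\<alpha> ` {..<nat \<lceil>b ?y\<rceil>})" by (intro card_mono) auto
    also have "\<dots> \<le> nat \<lceil>b ?y\<rceil>" using card_image_le[of "{..<nat \<lceil>b ?y\<rceil>}" \<alpha>] by simp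
    finally show ?case using b R1(1) by linarith
  qed
qed

text \<open>Aiming at \<open>q ^ 7\<close> leaves room on both sides for the lost factor
  \<open>C\<close> and the shift by \<open>K\<close>.\<close>

lemma slow_exponent_window:
  assumes inv: "ultimate_inverse (real m0) u v"
    and ratio: "\<forall>\<^sub>F R in at_top. u (R + 1) / u R < C" "C > 0"
    and \<mu>: "\<And>m. int (\<mu> m) = \<lfloor>u (real (m0 + m))\<rfloor> - K"
  shows "\<forall>\<^sub>F q in sequentially. \<exists>x\<in>range \<mu>. q ^ 3 \<le> x \<and> x \<le> q ^ 8"
proof -
  have "filterlim (\<lambda>q. real q ^ 7) at_top sequentially" by real_asymp
  with slow_growth_window[OF inv ratio(1)]
  have "\<forall>\<^sub>F q in sequentially. \<exists>m\<ge>m0. real q ^ 7 \<le> C * u (real m) \<and> u (real m) \<le> real q ^ 7"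
    by (rule eventually_compose_filterlim)
  moreover have "\<forall>\<^sub>F q in sequentially. C * (real q ^ 3 + of_int K + 1) \<le> real q ^ 7" using ratio(2) by real_asymp
  moreover have "\<forall>\<^sub>F q in sequentially. real q ^ 7 - of_int K \<le> real q ^ 8" by real_asymp
  ultimately show ?thesis
  proof eventually_elim
    case (elim q)
    obtain m where m: "m \<ge> m0" "real q ^ 7 \<le> C * u (real m)" "u (real m) \<le> real q ^ 7" using elim by blast
    have "C * (real q ^ 3 + of_int K + 1) \<le> C * u (real m)" using m elim by linarith
    then have lo: "real q ^ 3 + of_int K + 1 \<le> u (real m)" using ratio(2) by simp
    have eq: "int (\<mu> (m - m0)) = \<lfloor>u (real m)\<rfloor> - K" using \<mu>[of "m - m0"] m(1) by simp
    then have "real (\<mu> (m - m0)) = of_int (\<lfloor>u (real m)\<rfloor> - K)" by (metis of_int_of_nat_eq)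
    then have "real q ^ 3 \<le> real (\<mu> (m - m0))" "real (\<mu> (m - m0)) \<le> real q ^ 8"
      using lo m(3) elim(3) by linarith+
    then have "real (q ^ 3) \<le> real (\<mu> (m - m0))" "real (\<mu> (m - m0)) \<le> real (q ^ 8)" by simp_all
    then show ?case unfolding of_nat_le_iff by blast
  qed
qed

text \<open>The exponent \<open>\<delta> / 17\<close> leaves room:
  \<open>(3 * q ^ 16) powr (\<delta> / 17)\<close> has order
  \<open>q powr (16 * \<delta> / 17)\<close>, so all constants are absorbed.\<close>

lemma eventually_le_powr_exponent_bound:
  assumes b: "\<And>\<epsilon>. \<epsilon> > 0 \<Longrightarrow> \<forall>\<^sub>F x in at_top. b x \<le> x powr \<epsilon>"
    and card: "\<forall>\<^sub>F N in sequentially. real (card (S \<inter> {..<N})) \<le> b (real N + c) + 1"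
    and "\<delta> > 0"
  shows "\<forall>\<^sub>F q in sequentially. real (card (S \<inter> {..<3 * q ^ 16})) \<le> real q powr \<delta>"
proof -
  have "\<forall>\<^sub>F N in sequentially. b (real N + c) \<le> (real N + c) powr (\<delta> / 17)"
    by (rule eventually_real_plus[OF b]) (use assms in auto)
  with card have "\<forall>\<^sub>F N in sequentially. real (card (S \<inter> {..<N})) \<le> (real N + c) powr (\<delta> / 17) + 1"
    by eventually_elim auto
  moreover have "filterlim (\<lambda>q::nat. 3 * q ^ 16) sequentially sequentially"
  proof (rule filterlim_at_top_mono[OF filterlim_ident])
    show "\<forall>\<^sub>F q in sequentially. q \<le> 3 * q ^ 16"
      using eventually_ge_at_top[of 1]
    proof eventually_elim
      case (elim q)
      then have "q \<le> q ^ 16" by (intro self_le_power) simp_all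
      then show ?case by linarith
    qed
  qed
  ultimately have "\<forall>\<^sub>F q in sequentially. real (card (S \<inter> {..<3 * q ^ 16})) \<le> (real (3 * q ^ 16) + c) powr (\<delta> / 17) + 1"
    by (rule eventually_compose_filterlim)
  moreover have "\<forall>\<^sub>F q in sequentially. (real (3 * q ^ 16) + c) powr (\<delta> / 17) + 1 \<le> real q powr \<delta>"
    using \<open>\<delta> > 0\<close> by real_asymp
  ultimately show ?thesis by eventually_elim auto
qed

lemma card_supp_bipower_le:
  assumes "\<And>\<delta>. \<delta> > 0 \<Longrightarrow> \<forall>\<^sub>F q in sequentially. real (card (fps_supp F \<inter> {..<3 * q ^ 16})) \<le> real q powr \<delta>"
    "\<And>\<delta>. \<delta> > 0 \<Longrightarrow> \<forall>\<^sub>F q in sequentially. real (card (fps_supp G \<inter> {..<3 * q ^ 16})) \<le> real q powr \<delta>"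
  shows "\<forall>\<^sub>F q in sequentially. card (fps_supp (F ^ i * G ^ j) \<inter> {..<3 * q ^ 16}) \<le> q"
proof -
  \<comment> \<open>The \<open>i + j\<close> factors of size at most \<open>q powr \<delta>\<close>
    then multiply to at most \<open>q\<close>.\<close>
  define \<delta> where "\<delta> = 1 / real (i + j + 1)"
  have \<delta>: "\<delta> > 0" by (simp add: \<delta>_def)
  show ?thesis using assms(1)[OF \<delta>] assms(2)[OF \<delta>] eventually_ge_at_top[of 1]
  proof eventually_elim
    case (elim q)
    have "real (card (fps_supp (F ^ i * G ^ j) \<inter> {..<3 * q ^ 16})) \<le>
       real (card (fps_supp F \<inter> {..<3 * q ^ 16})) ^ i * real (card (fps_supp G \<inter> {..<3 * q ^ 16})) ^ j"
      using card_fps_supp_power_mult_power_le[of F i G j "3 * q ^ 16"]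
      by (metis of_nat_le_iff of_nat_mult of_nat_power)
    also have "\<dots> \<le> (real q powr \<delta>) ^ i * (real q powr \<delta>) ^ j"
      by (intro mult_mono power_mono elim) auto
    also have "\<dots> = real q powr (\<delta> * real (i + j))"
      using elim by (simp add: powr_power powr_add distrib_left mult.commute flip: power_add)
    also have "\<dots> \<le> real q powr 1"
      using elim by (intro powr_mono) (auto simp: \<delta>_def)
    finally show ?case using elim by simp
  qed
qed

text \<open>Pigeonhole: a point of \<open>S\<close> in each of the \<open>c + 1\<close> disjoint
  blocks below \<open>N\<close> would be one too many.\<close>

lemma free_block:
  fixes S :: "nat set"
  assumes "card (S \<inter> {..<N}) \<le> c" "w * (c + 1) \<le> N"
  obtains i where "i \<le> c" "S \<inter> {i * w..<(i + 1) * w} = {}"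
proof -
  have "\<exists>i\<le>c. S \<inter> {i * w..<(i + 1) * w} = {}"
  proof (rule ccontr)
    assume "\<not> ?thesis"
    then have "\<forall>i\<in>{..c}. \<exists>x. x \<in> S \<inter> {i * w..<(i + 1) * w}" by (simp only: ex_in_conv) blast
    then obtain f where f: "\<And>i. i \<le> c \<Longrightarrow> f i \<in> S \<inter> {i * w..<(i + 1) * w}"
      unfolding bchoice_iff by auto
    have "f i div w = i" if "i \<le> c" for i
      using f[OF that] by (intro div_nat_eqI) (auto simp: mult.commute)
    then have "inj_on f {..c}" by (intro inj_on_inverseI[of _ "\<lambda>x. x div w"]) auto
    moreover have "f ` {..c} \<subseteq> S \<inter> {..<N}"
    proof (intro subsetI, elim imageE)
      fix y i assume i: "y = f i" "i \<in> {..c}"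
      have fi: "f i \<in> S" "f i < (i + 1) * w" using f[of i] i(2) by auto
      have "(i + 1) * w \<le> (c + 1) * w" using i(2) by (intro mult_le_mono1) simp
      also have "\<dots> \<le> N" using assms(2) by (simp only: mult.commute)
      finally show "y \<in> S \<inter> {..<N}" using fi i(1) by simp
    qed
    ultimately have "card {..c} \<le> card (S \<inter> {..<N})" by (intro card_inj_on_le) auto
    then show False using assms(1) by simp
  qed
  then show ?thesis using that by blast
qed

section \<open>Greedy sums of exponents\<close>

context fast_growth
begin

text \<open>The saving is measured by \<open>b\<close> at the top scale \<open>N\<close> instead of
  the scale of the remainder \<open>r\<close>. As \<open>r\<close> is at least a power of
  \<open>N\<close> with exponent close to 1, \<open>ln_b_ratio\<close> keeps the loss within
  \<epsilon>.\<close>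

lemma greedy_step:
  fixes \<alpha> :: "nat \<Rightarrow> nat" and K :: int and k :: nat
  assumes \<alpha>: "\<And>m. int (\<alpha> m) = \<lfloor>a (real (m0 + m))\<rfloor> - K" and \<epsilon>: "0 < \<epsilon>" "\<epsilon> \<le> 1"
  shows "\<forall>\<^sub>F N in sequentially. \<forall>r. real N * b (real N + of_int K) powr (- real k) \<le> real r \<longrightarrow> r \<le> N \<longrightarrow>
     (\<exists>m. \<alpha> m \<le> r \<and> real (r - \<alpha> m) \<le> real r * b (real N + of_int K) powr (-1 + \<epsilon>))"
proof -
  \<comment> \<open>Of the three parts of \<epsilon>, one pays for
    \<open>greedy_approximation\<close>, one for the change of scale and one for the constant 3 at
    the end. The choice of \<delta> makes \<open>B powr real k\<close> at most
    \<open>y powr (\<epsilon>1 / 2)\<close>.\<close>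
  define \<epsilon>1 where "\<epsilon>1 = \<epsilon> / 3"
  define \<delta> where "\<delta> = \<epsilon>1 / (2 * real (k + 1))"
  have \<epsilon>1: "0 < \<epsilon>1" "\<epsilon>1 \<le> 1/3" using \<epsilon> by (auto simp: \<epsilon>1_def)
  have \<delta>: "0 < \<delta>" "real k * \<delta> \<le> \<epsilon>1 / 2" using \<epsilon>1 by (auto simp: \<delta>_def field_simps)
  have \<delta>2: "\<delta> \<le> 1 / 6"
  proof -
    have "\<epsilon>1 / (2 * real (k + 1)) \<le> \<epsilon>1 / 2" using \<epsilon>1 by (intro divide_left_mono) auto
    then show ?thesis using \<epsilon>1 by (simp add: \<delta>_def)
  qed
  have "\<forall>\<^sub>F x in at_top. (\<exists>m\<ge>m0. a (real m) \<le> x \<and> x - a (real m) \<le> x * b x powr (-1 + \<epsilon>1)) \<and>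
     (\<forall>y\<ge>x. ln (b y) * ln x \<le> ln (b x) * ln y) \<and> b x \<ge> 1"
    using greedy_approximation[of \<epsilon>1] ln_b_ratio eventually_b_ge[of 1] \<epsilon>1
    by (intro eventually_conj) auto
  then obtain X0 where X0: "\<And>x. x \<ge> X0 \<Longrightarrow> (\<exists>m\<ge>m0. a (real m) \<le> x \<and> x - a (real m) \<le> x * b x powr (-1 + \<epsilon>1)) \<and>
     (\<forall>y\<ge>x. ln (b y) * ln x \<le> ln (b x) * ln y) \<and> b x \<ge> 1"
    unfolding eventually_at_top_linorder by auto
  define X1 where "X1 = \<bar>X0\<bar> + \<bar>of_int K\<bar> + 1"
  have "\<forall>\<^sub>F N in sequentially. b (real N + of_int K) \<le> (real N + of_int K) powr \<delta>"
    by (rule eventually_real_plus[OF b_le_powr[OF \<delta>(1)]])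
  moreover have "\<forall>\<^sub>F N in sequentially. b (real N + of_int K) powr \<epsilon>1 \<ge> 3"
  proof -
    have "\<forall>\<^sub>F t::real in at_top. t powr \<epsilon>1 \<ge> 3" using \<epsilon>1(1) by real_asymp
    from eventually_real_plus[OF eventually_compose_filterlim[OF this b_at_top]] show ?thesis .
  qed
  moreover have "\<forall>\<^sub>F N in sequentially. b (real N + of_int K) \<ge> 3"
    by (rule eventually_real_plus[OF eventually_b_ge])
  moreover have "\<forall>\<^sub>F N in sequentially. (real N + of_int K) powr (\<epsilon>1 / 2) \<ge> 4"
    using \<epsilon>1(1) by real_asymp
  moreover have "\<forall>\<^sub>F N in sequentially. (real N + of_int K) powr (1 - \<epsilon>1) \<ge> X1"
  proof -
    have "1 - \<epsilon>1 > 0" using \<epsilon>1 by simp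
    then show ?thesis by real_asymp
  qed
  moreover have "\<forall>\<^sub>F N in sequentially. real N \<ge> (real N + of_int K) / 2" by real_asymp
  moreover have "\<forall>\<^sub>F N in sequentially. real N + of_int K \<ge> 2" by real_asymp
  ultimately show ?thesis
  proof eventually_elim
    case (elim N)
    define y where "y = real N + of_int K"
    define B where "B = b y"
    note e = elim[folded y_def, folded B_def]
    have y0: "y > 0" "y \<ge> 1" "ln y > 0" using e by auto
    have B0: "B > 0" "B \<ge> 1" "ln B \<ge> 0" using e by auto
    show ?case unfolding y_def[symmetric] B_def[symmetric]
    proof (intro allI impI)
      fix r assume r: "real N * B powr (- real k) \<le> real r" "r \<le> N"
      have "B powr real k \<le> (y powr \<delta>) powr real k" using e B0 by (intro powr_mono2) auto
      also have "\<dots> = y powr (real k * \<delta>)" by (simp add: powr_powr mult.commute)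
      also have "\<dots> \<le> y powr (\<epsilon>1 / 2)" using y0 \<delta> by (intro powr_mono) auto
      finally have "B powr real k \<le> y powr (\<epsilon>1 / 2)" .
      then have Bk: "y powr (- (\<epsilon>1 / 2)) \<le> B powr (- real k)"
        unfolding powr_minus using B0 by (intro le_imp_inverse_le) auto
      have "2 * y powr (1 - \<epsilon>1) \<le> y powr (\<epsilon>1 / 2) / 2 * y powr (1 - \<epsilon>1)"
        using e by (intro mult_right_mono) auto
      also have "\<dots> = y powr (1 - \<epsilon>1 / 2) / 2"
        by (simp flip: powr_add)
      also have "\<dots> = (y / 2) * y powr (- (\<epsilon>1 / 2))"
        using y0 powr_add[of y 1 "- (\<epsilon>1 / 2)"] by simp
      also have "\<dots> \<le> real N * B powr (- real k)"
        using e Bk y0 by (intro mult_mono) auto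
      finally have r2: "2 * y powr (1 - \<epsilon>1) \<le> real r" using r by linarith
      define x where "x = real r + of_int K"
      have yX1: "y powr (1 - \<epsilon>1) \<ge> X1" using e by simp
      have x: "x \<ge> y powr (1 - \<epsilon>1)" "x \<ge> X0" "x \<le> y" "x \<le> 2 * real r" "x > 0"
        using r2 yX1 r(2) unfolding x_def y_def X1_def by linarith+
      obtain n where n: "n \<ge> m0" "a (real n) \<le> x" "x - a (real n) \<le> x * b x powr (-1 + \<epsilon>1)"
        using X0[OF x(2)] by blast
      have bx: "b x \<ge> 1" and ratio: "ln B * ln x \<le> ln (b x) * ln y"
        using X0[OF x(2)] x(3) unfolding B_def by auto
      \<comment> \<open>Cancelling \<open>ln y\<close> in the ratio inequality turns
        \<open>x \<ge> y powr (1 - \<epsilon>1)\<close> into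
        \<open>b x \<ge> B powr (1 - \<epsilon>1)\<close>.\<close>
      have "ln (y powr (1 - \<epsilon>1)) \<le> ln x" using x y0 by (subst ln_le_cancel_iff) auto
      then have "(1 - \<epsilon>1) * ln y \<le> ln x" using y0 by (simp add: ln_powr)
      then have "ln B * ((1 - \<epsilon>1) * ln y) \<le> ln (b x) * ln y"
        using ratio mult_left_mono[OF _ B0(3)] by (meson order.trans)
      then have "(ln B * (1 - \<epsilon>1)) * ln y \<le> ln (b x) * ln y" by (simp add: mult.assoc)
      then have "ln B * (1 - \<epsilon>1) \<le> ln (b x)" using y0(3) mult_le_cancel_right_pos by blast
      then have "exp (ln B * (1 - \<epsilon>1)) \<le> exp (ln (b x))" by simp
      then have bB: "B powr (1 - \<epsilon>1) \<le> b x" using B0 bx by (simp add: powr_def mult.commute)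
      have "b x powr (-1 + \<epsilon>1) \<le> (B powr (1 - \<epsilon>1)) powr (-1 + \<epsilon>1)"
        using bB B0 \<epsilon>1 by (intro powr_mono2') auto
      also have "\<dots> = B powr ((1 - \<epsilon>1) * (-1 + \<epsilon>1))" by (simp add: powr_powr)
      also have "\<dots> \<le> B powr (-1 + 2 * \<epsilon>1)"
        using B0 by (intro powr_mono) (auto simp: algebra_simps)
      finally have bb: "b x powr (-1 + \<epsilon>1) \<le> B powr (-1 + 2 * \<epsilon>1)" .
      define m where "m = n - m0"
      have eq: "int (\<alpha> m) = \<lfloor>a (real n)\<rfloor> - K" using \<alpha>[of m] n(1) by (simp add: m_def)
      have "\<lfloor>a (real n)\<rfloor> \<le> int r + K" using n(2) unfolding x_def by linarith
      then have le: "\<alpha> m \<le> r" using eq by linarith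
      \<comment> \<open>Rounding to integers costs 1, which the main error term dominates.\<close>
      have one: "1 \<le> real r * B powr (-1 + 2 * \<epsilon>1)"
      proof -
        have "B \<le> y powr \<delta>" using e by simp
        also have "\<dots> \<le> y powr (1 - \<epsilon>1)" using y0 \<delta>2 \<epsilon>1 by (intro powr_mono) auto
        also have "\<dots> \<le> real r" using r2 powr_ge_zero[of y "1 - \<epsilon>1"] by linarith
        finally have "B \<le> real r" .
        then have "1 \<le> real r * B powr (-1)" using B0 by (simp add: powr_minus field_simps)
        also have "\<dots> \<le> real r * B powr (-1 + 2 * \<epsilon>1)"
          using B0 \<epsilon>1 by (intro mult_left_mono powr_mono) auto
        finally show ?thesis .
      qed
      have "real (r - \<alpha> m) = real r - real_of_int (int (\<alpha> m))" using le by (simp add: of_nat_diff)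
      also have "\<dots> \<le> x - a (real n) + 1" unfolding eq x_def by linarith
      also have "x - a (real n) \<le> x * B powr (-1 + 2 * \<epsilon>1)"
        by (rule order.trans[OF n(3)]) (use bb x in \<open>intro mult_left_mono, auto\<close>)
      also have "\<dots> \<le> 2 * real r * B powr (-1 + 2 * \<epsilon>1)"
        using x by (intro mult_right_mono) auto
      also have "2 * real r * B powr (-1 + 2 * \<epsilon>1) + 1 \<le> real r * B powr (-1 + 2 * \<epsilon>1) * 3"
        using one by simp
      also have "\<dots> \<le> real r * B powr (-1 + 2 * \<epsilon>1) * B powr \<epsilon>1"
        using e by (intro mult_left_mono) auto
      also have "\<dots> = real r * B powr (-1 + \<epsilon>)"
        by (simp add: mult.assoc \<epsilon>1_def flip: powr_add)
      finally have "real (r - \<alpha> m) \<le> real r * B powr (-1 + \<epsilon>)" by simp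
      then show "\<exists>m. \<alpha> m \<le> r \<and> real (r - \<alpha> m) \<le> real r * B powr (-1 + \<epsilon>)" using le by blast
    qed
  qed
qed

text \<open>Induction on the number of summands: each further exponent is the greedy choice for the
  current remainder and divides it by about \<open>B powr (1 - \<epsilon>)\<close>.\<close>

lemma greedy_sums:
  fixes \<alpha> :: "nat \<Rightarrow> nat" and K :: int and k :: nat
  assumes \<alpha>: "\<And>m. int (\<alpha> m) = \<lfloor>a (real (m0 + m))\<rfloor> - K" and \<epsilon>: "0 < \<epsilon>" "\<epsilon> \<le> 1"
    and F: "nonneg_fps F" "0 \<in> fps_supp F" "fps_supp F = range \<alpha>"
  shows "\<forall>\<^sub>F N in sequentially. \<forall>r\<le>N. \<exists>s\<in>fps_supp (F ^ k). s \<le> r \<and>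
     real (r - s) \<le> real N * b (real N + of_int K) powr (- (real k * (1 - \<epsilon>)))"
proof -
  have "\<forall>\<^sub>F N in sequentially. b (real N + of_int K) \<ge> 1"
    by (rule eventually_real_plus[OF eventually_b_ge])
  with greedy_step[OF \<alpha> \<epsilon>, of k] show ?thesis
  proof eventually_elim
    case (elim N)
    define B where "B = b (real N + of_int K)"
    note e = elim[folded B_def]
    have "\<forall>r\<le>N. \<exists>s\<in>fps_supp (F ^ j). s \<le> r \<and> real (r - s) \<le> real N * B powr (- (real j * (1 - \<epsilon>)))" if "j \<le> k" for j
      using that
    proof (induction j)
      case 0
      then show ?case using e by (auto simp: fps_supp_def intro!: exI[of _ 0])
    next
      case (Suc j)
      show ?case
      proof (intro allI impI)
        fix r assume r: "r \<le> N"
        obtain s where s: "s \<in> fps_supp (F ^ j)" "s \<le> r" "real (r - s) \<le> real N * B powr (- (real j * (1 - \<epsilon>)))"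
          using Suc r by auto
        have mem: "x + s \<in> fps_supp (F ^ Suc j)" if "x \<in> fps_supp F" for x
          using fps_supp_multI[OF F(1) nonneg_fps_power[OF F(1)] that s(1)] by simp
        show "\<exists>s\<in>fps_supp (F ^ Suc j). s \<le> r \<and> real (r - s) \<le> real N * B powr (- (real (Suc j) * (1 - \<epsilon>)))"
        proof (cases "real N * B powr (- real k) \<le> real (r - s)")
          case True
          have "r - s \<le> N" using r by simp
          then obtain m where m: "\<alpha> m \<le> r - s" "real (r - s - \<alpha> m) \<le> real (r - s) * B powr (-1 + \<epsilon>)"
            using e(1) True by blast
          have "real (r - (\<alpha> m + s)) = real (r - s - \<alpha> m)" by (simp add: add.commute)
          also have "\<dots> \<le> real (r - s) * B powr (-1 + \<epsilon>)" by (rule m(2))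
          also have "\<dots> \<le> (real N * B powr (- (real j * (1 - \<epsilon>)))) * B powr (-1 + \<epsilon>)"
            by (intro mult_right_mono s) auto
          also have "\<dots> = real N * B powr (- (real (Suc j) * (1 - \<epsilon>)))"
            by (simp add: mult.assoc algebra_simps flip: powr_add)
          finally show ?thesis using mem[of "\<alpha> m"] F(3) m(1) s(2) by (intro bexI[of _ "\<alpha> m + s"]) auto
        next
          \<comment> \<open>A remainder below the range of \<open>greedy_step\<close> already
            satisfies the bound for every number of summands up to \<open>k\<close>, so the exponent
            0 is added.\<close>
          case False
          then have "real (r - s) \<le> real N * B powr (- real k)" by simp
          also have "\<dots> \<le> real N * B powr (- (real (Suc j) * (1 - \<epsilon>)))"
          proof (intro mult_left_mono powr_mono)
            have "real (Suc j) * (1 - \<epsilon>) \<le> real k * 1" using Suc.prems \<epsilon> by (intro mult_mono) auto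
            then show "- real k \<le> - (real (Suc j) * (1 - \<epsilon>))" by simp
          qed (use e in auto)
          finally show ?thesis using mem[of 0] F(2) s(2) by (intro bexI[of _ s]) auto
        qed
      qed
    qed
    from this[of k] show ?case unfolding B_def by simp
  qed
qed

text \<open>The two series carry different shifts of the argument. Such a shift stays below
  \<open>x\<^sup>2\<close>, so by \<open>ln_b_ratio\<close> it at most squares
  \<open>b x\<close>.\<close>

lemma b_shift: "\<forall>\<^sub>F x in at_top. b (x + c) \<le> b x powr 2"
proof -
  have mono: "\<forall>\<^sub>F x in at_top. \<forall>y\<ge>x + c. b (x + c) \<le> b y"
  proof -
    have "filterlim (\<lambda>x::real. x + c) at_top at_top" by real_asymp
    with ultimate_inverse_eventually(2)[OF inverse] show ?thesis by (rule eventually_compose_filterlim)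
  qed
  have big: "\<forall>\<^sub>F x in at_top. \<forall>y\<ge>x. b y \<ge> 1"
    by (rule eventually_all_ge_at_top[OF eventually_b_ge])
  have "\<forall>\<^sub>F x::real in at_top. x + \<bar>c\<bar> \<le> x\<^sup>2" by real_asymp
  with mono big show ?thesis using ln_b_ratio eventually_ge_at_top[of 2]
  proof eventually_elim
    case (elim x)
    define z where "z = x + \<bar>c\<bar>"
    have z: "z \<ge> x" "z \<ge> x + c" "z \<le> x\<^sup>2" using elim by (auto simp: z_def)
    have "b (x + c) \<le> b z" using elim z by auto
    also have "b z \<le> b x powr 2"
    proof -
      have "ln (b x) \<ge> 0" "ln x > 0" using elim by auto
      have "ln z \<le> ln (x\<^sup>2)" using z elim by (subst ln_le_cancel_iff) auto
      then have "ln z \<le> 2 * ln x" using elim by (simp add: ln_realpow)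
      then have "ln (b x) * ln z \<le> ln (b x) * (2 * ln x)" using \<open>ln (b x) \<ge> 0\<close> by (intro mult_left_mono)
      moreover have "ln (b z) * ln x \<le> ln (b x) * ln z" using elim z by auto
      ultimately have "ln (b z) * ln x \<le> (2 * ln (b x)) * ln x" by simp
      then have "ln (b z) \<le> 2 * ln (b x)" using \<open>ln x > 0\<close> mult_le_cancel_right_pos by blast
      then have "exp (ln (b z)) \<le> exp (2 * ln (b x))" by simp
      moreover have "b z \<ge> 1" "b x \<ge> 1" using elim z by auto
      ultimately show ?thesis by (simp add: powr_def)
    qed
    finally show ?case .
  qed
qed

text \<open>With \<open>B = b (N + c)\<close>, the \<open>k - 1\<close> factors \<open>F\<close>
  contribute about \<open>B powr (k - 1)\<close> and the \<open>J\<close> factors \<open>G\<close>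
  only \<open>B powr (1 / 16)\<close>. Constants and the \<open>+ 1\<close> fit into the rest of the
  exponent.\<close>

lemma card_lower_sums:
  fixes v :: "real \<Rightarrow> real"
  assumes cF: "\<forall>\<^sub>F N in sequentially. real (card (fps_supp F \<inter> {..<N})) \<le> b (real N + c) + 1"
    and cG: "\<forall>\<^sub>F N in sequentially. real (card (fps_supp G \<inter> {..<N})) \<le> v (real N + d) + 1"
    and v: "\<And>\<epsilon>. \<epsilon> > 0 \<Longrightarrow> \<forall>\<^sub>F x in at_top. v x \<le> b x powr \<epsilon>" and k: "k > 0"
  shows "\<forall>\<^sub>F N in sequentially. real (card (fps_supp (F ^ (k - 1) * G ^ J) \<inter> {..<N}) + 1)
     \<le> b (real N + c) powr (real k - 3 / 4)"
proof -
  \<comment> \<open>Each factor \<open>G\<close> costs \<open>B powr (4 * \<eta>)\<close>: one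
    doubling of \<eta> comes from \<open>b_shift\<close>, another from absorbing a
    \<open>+ 1\<close>.\<close>
  define \<eta> where "\<eta> = 1 / (64 * real (J + 1))"
  have \<eta>: "\<eta> > 0" "4 * \<eta> * real J \<le> 1 / 16" by (auto simp: \<eta>_def field_simps)
  have Bev: "\<forall>\<^sub>F N in sequentially. P (b (real N + c))" if "\<forall>\<^sub>F t in at_top. P t" for P
    by (rule eventually_real_plus[OF eventually_compose_filterlim[OF that b_at_top]])
  have "\<forall>\<^sub>F N in sequentially. v (real N + d) \<le> b (real N + d) powr \<eta>"
    by (rule eventually_real_plus[OF v[OF \<eta>(1)]])
  moreover have "\<forall>\<^sub>F N in sequentially. b (real N + d) \<ge> 0"
    by (rule eventually_real_plus[OF eventually_b_ge])
  moreover have "\<forall>\<^sub>F N in sequentially. b (real N + c + (d - c)) \<le> b (real N + c) powr 2"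
    by (rule eventually_real_plus[OF b_shift])
  moreover have "\<forall>\<^sub>F N in sequentially. b (real N + c) \<ge> 1"
    by (rule eventually_real_plus[OF eventually_b_ge])
  moreover have "\<forall>\<^sub>F N in sequentially. b (real N + c) powr (2 * \<eta>) \<ge> 2"
    by (rule Bev) (use \<eta>(1) in real_asymp)
  moreover have "\<forall>\<^sub>F N in sequentially. b (real N + c) powr (1 / 16) \<ge> 2 ^ (k - 1)"
    by (rule Bev) real_asymp
  moreover have "\<forall>\<^sub>F N in sequentially. b (real N + c) powr (1 / 8) \<ge> 2"
    by (rule Bev) real_asymp
  ultimately show ?thesis using cF cG
  proof eventually_elim
    case (elim N)
    define B where "B = b (real N + c)"
    note e = elim[folded B_def]
    have B0: "B \<ge> 1" "B > 0" using e by auto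
    have "real (card (fps_supp G \<inter> {..<N})) \<le> b (real N + d) powr \<eta> + 1" using e by linarith
    also have "b (real N + d) powr \<eta> \<le> (B powr 2) powr \<eta>"
      using e \<eta> by (intro powr_mono2) auto
    also have "\<dots> + 1 = B powr (2 * \<eta>) + 1" by (simp add: powr_powr)
    also have "\<dots> \<le> B powr (2 * \<eta>) * B powr (2 * \<eta>)"
      using e mult_mono[of 2 "B powr (2 * \<eta>)" "B powr (2 * \<eta>)" "B powr (2 * \<eta>)"] by linarith
    also have "\<dots> = B powr (4 * \<eta>)" by (simp flip: powr_add)
    finally have G: "real (card (fps_supp G \<inter> {..<N})) \<le> B powr (4 * \<eta>)" by simp
    have F: "real (card (fps_supp F \<inter> {..<N})) \<le> 2 * B" using e by linarith
    have "real (card (fps_supp (F ^ (k - 1) * G ^ J) \<inter> {..<N})) \<le>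
       real (card (fps_supp F \<inter> {..<N})) ^ (k - 1) * real (card (fps_supp G \<inter> {..<N})) ^ J"
      using card_fps_supp_power_mult_power_le[of F "k - 1" G J N]
      by (metis of_nat_le_iff of_nat_mult of_nat_power)
    also have "\<dots> \<le> (2 * B) ^ (k - 1) * (B powr (4 * \<eta>)) ^ J"
      using F G B0 by (intro mult_mono power_mono) auto
    also have "\<dots> = 2 ^ (k - 1) * (B powr real (k - 1) * B powr (4 * \<eta> * real J))"
      using B0 by (simp add: power_mult_distrib powr_realpow powr_power mult.assoc mult.commute[of "real J"])
    also have "\<dots> \<le> B powr (1 / 16) * (B powr real (k - 1) * B powr (1 / 16))"
      using e \<eta> B0 by (intro mult_mono powr_mono) auto
    also have "\<dots> = B powr (real k - 7 / 8)" using k by (simp add: of_nat_diff algebra_simps flip: powr_add)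
    finally have "real (card (fps_supp (F ^ (k - 1) * G ^ J) \<inter> {..<N}) + 1) \<le> B powr (real k - 7 / 8) + 1" by simp
    also have "1 \<le> B powr (real k - 7 / 8)" using B0 k by (intro ge_one_powr_ge_zero) auto
    then have "B powr (real k - 7 / 8) + 1 \<le> B powr (real k - 7 / 8) * 2" by simp
    also have "\<dots> \<le> B powr (real k - 7 / 8) * B powr (1 / 8)" using e by (intro mult_left_mono) auto
    also have "\<dots> = B powr (real k - 3 / 4)" by (simp flip: powr_add)
    finally show ?case unfolding B_def .
  qed
qed

text \<open>A block of length about \<open>N / B\<^bsup>k-3/4\<^esup>\<close>, with \<open>B = b N\<close>, misses the support of \<open>F\<^bsup>k-1\<^esup> G\<^sup>J\<close>; a greedy
  \<open>k\<close>-fold sum approximates two thirds of that block from below with error at most \<open>N / B\<^bsup>k-1/4\<^esup>\<close>.\<close>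
lemma isolated_power_sum:
  fixes \<alpha> :: "nat \<Rightarrow> nat" and K :: int and k :: nat and v :: "real \<Rightarrow> real"
  assumes \<alpha>: "\<And>m. int (\<alpha> m) = \<lfloor>a (real (m0 + m))\<rfloor> - K"
    and F: "nonneg_fps F" "0 \<in> fps_supp F" "fps_supp F = range \<alpha>"
    and cG: "\<forall>\<^sub>F N in sequentially. real (card (fps_supp G \<inter> {..<N})) \<le> v (real N + d) + 1"
    and v: "\<And>\<epsilon>. \<epsilon> > 0 \<Longrightarrow> \<forall>\<^sub>F x in at_top. v x \<le> b x powr \<epsilon>" and k: "k > 0"
  shows "\<forall>\<^sub>F N in sequentially. \<exists>s\<in>fps_supp (F ^ k). s \<le> N \<and>
    (\<forall>t\<in>fps_supp (F ^ (k - 1) * G ^ J). real t + real N powr (3/4) < real s \<or> real s + real N powr (3/4) < real t)"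
proof -
  \<comment> \<open>This choice makes the error of a \<open>k\<close>-fold greedy sum
    \<open>N * B powr (1 / 4 - k)\<close>, called \<open>X\<close> below.\<close>
  define \<epsilon> where "\<epsilon> = 1 / (4 * real k)"
  have \<epsilon>: "0 < \<epsilon>" "\<epsilon> \<le> 1" using k by (auto simp: \<epsilon>_def)
  have exponent: "- (real k * (1 - \<epsilon>)) = 1 / 4 - real k" using k by (simp add: \<epsilon>_def field_simps)
  let ?y = "\<lambda>N. real N + of_int K"
  \<comment> \<open>\<open>B powr k\<close> is then at most the eighth root of \<open>?y N\<close>,
    so \<open>X\<close> has order at least \<open>N powr (7 / 8)\<close> and dominates
    \<open>P\<close>.\<close>
  define \<delta> where "\<delta> = 1 / (8 * real k)"
  have \<delta>: "\<delta> > 0" "real k * \<delta> = 1 / 8" using k by (auto simp: \<delta>_def)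
  have cF: "\<forall>\<^sub>F N in sequentially. real (card (fps_supp F \<inter> {..<N})) \<le> b (?y N) + 1"
    unfolding F(3) by (rule card_exponents_le[OF inverse \<alpha>])
  note sums = greedy_sums[OF \<alpha> \<epsilon> F, of k, unfolded exponent]
  have lower: "\<forall>\<^sub>F N in sequentially. real (card (fps_supp (F ^ (k - 1) * G ^ J) \<inter> {..<N}) + 1)
     \<le> b (?y N) powr (real k - 3 / 4)"
    by (rule card_lower_sums[OF cF cG _ k]) (rule v)
  have "\<forall>\<^sub>F N in sequentially. b (?y N) powr (1 / 2) \<ge> 12"
  proof -
    have "\<forall>\<^sub>F t::real in at_top. t powr (1 / 2) \<ge> 12" by real_asymp
    from eventually_real_plus[OF eventually_compose_filterlim[OF this b_at_top]] show ?thesis .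
  qed
  moreover have "\<forall>\<^sub>F N in sequentially. b (?y N) \<ge> 1"
    by (rule eventually_real_plus[OF eventually_b_ge])
  moreover have "\<forall>\<^sub>F N in sequentially. b (?y N) \<le> ?y N powr \<delta>"
    by (rule eventually_real_plus[OF b_le_powr[OF \<delta>(1)]])
  moreover have "\<forall>\<^sub>F N in sequentially. real N * ?y N powr (- (1 / 8)) \<ge> 10 * real N powr (3/4) + 10"
    by real_asymp
  ultimately show ?thesis using sums lower
  proof eventually_elim
    case (elim N)
    define B where "B = b (?y N)"
    note e = elim[folded B_def]
    have B0: "B \<ge> 1" "B > 0" using e by auto
    define S where "S = fps_supp (F ^ (k - 1) * G ^ J)"
    define c where "c = card (S \<inter> {..<N})"
    define X where "X = real N * B powr (1 / 4 - real k)"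
    define P where "P = real N powr (3/4)"
    have P0: "P \<ge> 0" by (simp add: P_def)
    have XP: "X \<ge> 10 * P + 10"
    proof -
      have "B powr real k \<le> (?y N powr \<delta>) powr real k" using e B0 by (intro powr_mono2) auto
      also have "\<dots> = ?y N powr (1 / 8)" by (simp only: powr_powr mult.commute[of \<delta>] \<delta>(2))
      finally have "?y N powr (- (1 / 8)) \<le> B powr (- real k)"
        unfolding powr_minus using B0 by (intro le_imp_inverse_le) auto
      also have "\<dots> \<le> B powr (1 / 4 - real k)" using B0 by (intro powr_mono) auto
      finally have "real N * ?y N powr (- (1 / 8)) \<le> X" unfolding X_def by (intro mult_left_mono) auto
      then show ?thesis using e unfolding P_def by linarith
    qed
    have c: "real (c + 1) \<le> B powr (real k - 3 / 4)" using e unfolding c_def S_def by simp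
    \<comment> \<open>\<open>c + 1\<close> blocks of length \<open>w\<close> fit below
      \<open>N\<close>, so one of them misses \<open>S\<close>. The exponents
      \<open>k - 3 / 4\<close> and \<open>k - 1 / 4\<close> differ by 1/2, which makes
      \<open>w\<close> at least \<open>12 * X - 1\<close>.\<close>
    define w where "w = N div (c + 1)"
    have "12 * X \<le> B powr (1 / 2) * X" using e XP P0 by (intro mult_right_mono) auto
    also have "\<dots> = real N * B powr (- (real k - 3 / 4))"
      by (simp add: X_def mult.left_commute flip: powr_add)
    also have "\<dots> = real N / B powr (real k - 3 / 4)" by (simp only: powr_minus divide_inverse)
    also have "\<dots> \<le> real N / real (c + 1)" using c B0 by (intro divide_left_mono mult_pos_pos) auto
    also have "\<dots> \<le> real w + 1"
    proof -
      have "N < (c + 1) * (w + 1)" unfolding w_def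
        by (metis Suc_eq_plus1 dividend_less_times_div zero_less_Suc add.commute mult_Suc_right)
      then have "real N < real ((c + 1) * (w + 1))" by (simp only: of_nat_less_iff)
      then have "real N \<le> (real w + 1) * real (c + 1)" by (simp add: algebra_simps)
      then show ?thesis by (simp add: divide_le_eq del: of_nat_add)
    qed
    finally have w: "12 * X - 1 \<le> real w" by simp
    have wN: "w * (c + 1) \<le> N" unfolding w_def by (rule div_times_less_eq_dividend)
    obtain i where i: "i \<le> c" "S \<inter> {i * w..<(i + 1) * w} = {}"
      using free_block[OF _ wN, of S] unfolding c_def by blast
    have "(i + 1) * w \<le> (c + 1) * w" using i(1) by (intro mult_le_mono1) simp
    also have "\<dots> \<le> N" using wN by (simp only: mult.commute)
    finally have iwN: "i * w + w \<le> N" by simp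
    \<comment> \<open>The target at two thirds leaves \<open>w / 3\<close> above it and, after an
      error of at most \<open>X\<close>, still more than \<open>P\<close> below it inside the
      block.\<close>
    define r where "r = i * w + 2 * w div 3"
    have "r \<le> N" using iwN unfolding r_def by linarith
    then obtain s where s: "s \<in> fps_supp (F ^ k)" "s \<le> r" "real (r - s) \<le> X"
      using e unfolding X_def by blast
    have r1: "real r \<ge> real (i * w) + 2 * real w / 3 - 1" "real r \<le> real (i * w) + 2 * real w / 3"
      unfolding r_def by linarith+
    have s1: "real s \<ge> real r - X" using s by (simp add: of_nat_diff)
    have "real t + P < real s \<or> real s + P < real t" if t: "t \<in> S" for t
    proof -
      have "t < i * w \<or> t \<ge> i * w + w" using i(2) t by (auto simp: not_less)
      then show ?thesis
      proof
        assume "t < i * w"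
        then have "real t < real (i * w)" by (simp only: of_nat_less_iff)
        then have "real t + P < real s" using r1 s1 w XP P0 by linarith
        then show ?thesis ..
      next
        assume "t \<ge> i * w + w"
        then have "real (i * w + w) \<le> real t" by (simp only: of_nat_le_iff)
        then have "real (i * w) + real w \<le> real t" by simp
        moreover have "real s \<le> real r" using s(2) by simp
        ultimately have "real s + P < real t" using r1 w XP P0 by linarith
        then show ?thesis ..
      qed
    qed
    then show ?case using s(1,2) \<open>r \<le> N\<close> unfolding S_def P_def by (intro bexI[of _ s]) auto
  qed
qed

end

section \<open>Algebraic independence\<close>

text \<open>Beyond \<open>M\<close> the values increase, so the minimum over \<open>{..M}\<close> is
  global. Subtracting it makes 0 an exponent, which nests the supports of the powers.\<close>

lemma strict_mono_int_shift_to_nat: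
  fixes f :: "nat \<Rightarrow> int"
  assumes "strict_mono_on {M..} f"
  obtains K \<alpha> where "\<And>m. int (\<alpha> m) = f m - K" "0 \<in> range \<alpha>" "strict_mono_on {M..} \<alpha>"
proof -
  define K where "K = Min (f ` {..M})"
  have le: "K \<le> f m" for m
  proof (cases "m \<le> M")
    case False
    then have "f M \<le> f m" using strict_mono_on_leD[OF assms, of M m] by auto
    moreover have "K \<le> f M" by (simp add: K_def)
    ultimately show ?thesis by simp
  qed (simp add: K_def)
  have "K \<in> f ` {..M}" unfolding K_def by (intro Min_in) auto
  then obtain n where n: "f n = K" by auto
  show ?thesis
  proof (rule that[of "\<lambda>m. nat (f m - K)" K])
    show "int (nat (f m - K)) = f m - K" for m using le[of m] by simp
    show "0 \<in> range (\<lambda>m. nat (f m - K))" by (rule image_eqI[of _ _ n]) (auto simp: n)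
    show "strict_mono_on {M..} (\<lambda>m. nat (f m - K))"
    proof (rule strict_mono_onI)
      fix r s assume "r \<in> {M..}" "s \<in> {M..}" "r < s"
      then have "f r < f s" using strict_mono_onD[OF assms] by auto
      then show "nat (f r - K) < nat (f s - K)" using le[of r] by linarith
    qed
  qed
qed

lemma floor_series:
  fixes f :: "nat \<Rightarrow> int" and \<beta> :: real
  assumes "ultimately_increasing f" "\<beta> > 1"
  obtains K \<alpha> F where "\<And>m. int (\<alpha> m) = f (m0 + m) - K" "digit_series F" "nonneg_fps F"
    "fps_supp F = range \<alpha>" "0 \<in> fps_supp F"
    "(\<Sum>m. \<beta> powi (- f (m0 + m))) = \<beta> powi (- K) * eval_fps F (1 / \<beta>)"
proof -
  obtain M where "strict_mono_on {M..} f" using assms(1) unfolding ultimately_increasing_def by blast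
  then have "strict_mono_on {M..} (\<lambda>m. f (m0 + m))"
    by (auto simp: strict_mono_on_def)
  then obtain K \<alpha> where \<alpha>: "\<And>m. int (\<alpha> m) = f (m0 + m) - K" "0 \<in> range \<alpha>" "strict_mono_on {M..} \<alpha>"
    by (rule strict_mono_int_shift_to_nat) (rule that)
  obtain F where F: "digit_series F" "nonneg_fps F" "fps_supp F = range \<alpha>"
    "\<And>x. \<bar>x\<bar> < 1 \<Longrightarrow> (\<lambda>m. x ^ \<alpha> m) sums eval_fps F x"
    by (rule exponent_series[OF \<alpha>(3)]) (rule that)
  have "(\<lambda>m. (1 / \<beta>) ^ \<alpha> m) sums eval_fps F (1 / \<beta>)"
    using assms(2) by (intro F(4)) auto
  then have "(\<lambda>m. \<beta> powi (- K) * (1 / \<beta>) ^ \<alpha> m) sums (\<beta> powi (- K) * eval_fps F (1 / \<beta>))"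
    by (rule sums_mult)
  moreover have "\<beta> powi (- K) * (1 / \<beta>) ^ \<alpha> m = \<beta> powi (- f (m0 + m))" for m
  proof -
    have "(1 / \<beta>) ^ \<alpha> m = \<beta> powi (- int (\<alpha> m))"
      by (simp add: power_int_minus power_one_over inverse_eq_divide)
    then have "\<beta> powi (- K) * (1 / \<beta>) ^ \<alpha> m = \<beta> powi (- K + - int (\<alpha> m))"
      using assms(2) by (subst power_int_add) auto
    then show ?thesis using \<alpha>(1)[of m] by simp
  qed
  ultimately have "(\<Sum>m. \<beta> powi (- f (m0 + m))) = \<beta> powi (- K) * eval_fps F (1 / \<beta>)"
    by (simp add: sums_iff)
  then show ?thesis using that[OF \<alpha>(1) F(1-3)] \<alpha>(2) F(3) by simp
qed

section \<open>From a rational relation to a series vanishing at the reciprocal of \<beta>\<close>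

lemma common_denominator:
  fixes r :: "'a \<Rightarrow> rat"
  assumes "finite I"
  obtains D :: int where "D > 0" "\<And>p. p \<in> I \<Longrightarrow> of_int D * r p \<in> \<int>"
proof -
  have "\<exists>D::int. D > 0 \<and> (\<forall>p\<in>I. of_int D * r p \<in> \<int>)"
    using assms
  proof (induction I)
    case empty
    show ?case by (intro exI[of _ 1]) auto
  next
    case (insert q I)
    then obtain D :: int where D: "D > 0" "\<forall>p\<in>I. of_int D * r p \<in> \<int>" by blast
    obtain n d where nd: "r q = of_int n / of_int d" "d > 0"
      by (metis quotient_of_div quotient_of_denom_pos surj_pair)
    have "of_int (D * d) * r p \<in> \<int>" if "p \<in> insert q I" for p
    proof (cases "p = q")
      case True
      then have "of_int (D * d) * r p = of_int (D * n)" using nd by simp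
      then show ?thesis by (metis Ints_of_int)
    next
      case False
      then have "of_int D * r p \<in> \<int>" using that D by auto
      then have "of_int d * (of_int D * r p) \<in> \<int>" by (rule Ints_mult[OF Ints_of_int])
      moreover have "of_int d * (of_int D * r p) = of_int (D * d) * r p" by simp
      ultimately show ?thesis by (simp only:)
    qed
    then show ?case using D nd by (intro exI[of _ "D * d"]) auto
  qed
  then show ?thesis using that by blast
qed

text \<open>Expand \<open>P\<close> and clear denominators. Only pairs with nonzero coefficient
  enter \<open>I\<close>, so its lexicographic maximum is a true leading term.\<close>

lemma eval2_zero_int_relation:
  assumes "P \<noteq> 0" "eval2 P x y = 0"
  obtains I :: "(nat \<times> nat) set" and c :: "nat \<times> nat \<Rightarrow> int" where "finite I" "I \<noteq> {}"
    "\<And>p. p \<in> I \<Longrightarrow> c p \<noteq> 0" "(\<Sum>p\<in>I. of_int (c p) * (x ^ fst p * y ^ snd p)) = 0"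
proof -
  define A where "A = (\<lambda>p. coeff (coeff P (snd p)) (fst p))"
  define n where "n = Max ((\<lambda>j. degree (coeff P j)) ` {..degree P})"
  let ?R = "{..n} \<times> {..degree P}"
  define I where "I = {p \<in> ?R. A p \<noteq> 0}"
  have fin: "finite I" by (simp add: I_def)
  have deg: "degree (coeff P j) \<le> n" if "j \<le> degree P" for j
    unfolding n_def using that by (intro Max_ge) auto
  have "coeff (coeff P (degree P)) (degree (coeff P (degree P))) \<noteq> 0" using assms(1) by simp
  then have "(degree (coeff P (degree P)), degree P) \<in> I"
    using deg[of "degree P"] by (simp add: I_def A_def)
  then have ne: "I \<noteq> {}" by blast
  have inner: "poly (map_poly of_rat q) x = (\<Sum>i\<le>n. of_rat (coeff q i) * x ^ i)" if "degree q \<le> n" for q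
  proof -
    have "poly (map_poly of_rat q) x = (\<Sum>i\<le>degree q. of_rat (coeff q i) * x ^ i)"
      by (simp add: poly_altdef)
    also have "\<dots> = (\<Sum>i\<le>n. of_rat (coeff q i) * x ^ i)"
      using that by (intro sum.mono_neutral_left) (auto simp: coeff_eq_0)
    finally show ?thesis .
  qed
  have "eval2 P x y = (\<Sum>j\<le>degree P. poly (map_poly of_rat (coeff P j)) x * y ^ j)"
  proof -
    define Q where "Q = map_poly (\<lambda>q. poly (map_poly of_rat q) x) P"
    have cQ: "coeff Q j = poly (map_poly of_rat (coeff P j)) x" for j
      unfolding Q_def by (subst coeff_map_poly) auto
    have "degree Q \<le> degree P" unfolding Q_def by (rule degree_map_poly_le)
    then have "poly Q y = (\<Sum>j\<le>degree P. coeff Q j * y ^ j)"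
      unfolding poly_altdef by (intro sum.mono_neutral_left) (auto simp: coeff_eq_0)
    then show ?thesis by (simp add: eval2_def Q_def[symmetric] cQ)
  qed
  also have "\<dots> = (\<Sum>j\<le>degree P. \<Sum>i\<le>n. of_rat (A (i, j)) * (x ^ i * y ^ j))"
    by (intro sum.cong refl) (simp add: inner[OF deg] sum_distrib_right A_def mult.assoc)
  also have "\<dots> = (\<Sum>i\<le>n. \<Sum>j\<le>degree P. of_rat (A (i, j)) * (x ^ i * y ^ j))"
    by (rule sum.swap)
  also have "\<dots> = (\<Sum>p\<in>?R. of_rat (A p) * (x ^ fst p * y ^ snd p))"
    by (simp add: sum.cartesian_product case_prod_beta)
  also have "\<dots> = (\<Sum>p\<in>I. of_rat (A p) * (x ^ fst p * y ^ snd p))"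
    unfolding I_def by (intro sum.mono_neutral_right) auto
  finally have zero: "(\<Sum>p\<in>I. of_rat (A p) * (x ^ fst p * y ^ snd p)) = 0" using assms(2) by simp
  obtain D :: int where D: "D > 0" "\<And>p. p \<in> I \<Longrightarrow> of_int D * A p \<in> \<int>"
    using common_denominator[OF fin, of A] by blast
  define c where "c = (\<lambda>p. \<lfloor>of_int D * A p\<rfloor>)"
  have c: "rat_of_int (c p) = of_int D * A p" if "p \<in> I" for p
    using D(2)[OF that] by (auto simp: c_def elim: Ints_cases)
  have cr: "real_of_int (c p) = of_int D * of_rat (A p)" if "p \<in> I" for p
    using arg_cong[OF c[OF that], of "of_rat :: rat \<Rightarrow> real"] by (simp add: of_rat_mult)
  show ?thesis
  proof (rule that[OF fin ne, of c])
    fix p assume p: "p \<in> I"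
    then have "A p \<noteq> 0" by (simp add: I_def)
    then show "c p \<noteq> 0" using c[OF p] D(1) by auto
  next
    have "(\<Sum>p\<in>I. of_int (c p) * (x ^ fst p * y ^ snd p)) =
        (\<Sum>p\<in>I. of_int D * (of_rat (A p) * (x ^ fst p * y ^ snd p)))"
      by (intro sum.cong refl) (simp add: cr)
    then show "(\<Sum>p\<in>I. of_int (c p) * (x ^ fst p * y ^ snd p)) = 0"
      using zero by (simp flip: sum_distrib_left)
  qed
qed

lemma eval_fps_bipoly:
  assumes "digit_series F" "digit_series G" "\<bar>x\<bar> < 1"
  shows "eval_fps (fps_bipoly I c e F G) x =
    (\<Sum>p\<in>I. of_int (c p) * (x ^ e p * (eval_fps F x ^ fst p * eval_fps G x ^ snd p)))"
proof -
  have rad: "ereal (norm x) < fps_conv_radius f" if "digit_series f" for f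
    using digit_series_conv_radius[OF that, of x] assms(3) by simp
  have mult: "eval_fps (f * g) x = eval_fps f x * eval_fps g x" if "digit_series f" "digit_series g" for f g
    using that by (intro eval_fps_mult rad)
  have add: "eval_fps (f + g) x = eval_fps f x + eval_fps g x" if "digit_series f" "digit_series g" for f g
    using that by (intro eval_fps_add rad)
  have power: "eval_fps (f ^ k) x = eval_fps f x ^ k" if "digit_series f" for f k
    by (induction k) (auto simp: mult digit_series_power that)
  have X: "digit_series fps_X" using digit_series_X_power[of 1] by simp
  have term_eval: "eval_fps (fps_const (of_int (c p)) * (fps_X ^ e p * (F ^ fst p * G ^ snd p))) x =
      of_int (c p) * (x ^ e p * (eval_fps F x ^ fst p * eval_fps G x ^ snd p))" for p
    using assms X by (simp add: mult power digit_series_mult digit_series_power digit_series_of_int)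
  have term_digit: "digit_series (fps_const (of_int (c p)) * (fps_X ^ e p * (F ^ fst p * G ^ snd p)))" for p
    using assms by (intro digit_series_mult digit_series_of_int digit_series_X_power digit_series_power)
  show ?thesis unfolding fps_bipoly_def
  proof (induction I rule: infinite_finite_induct)
    case (insert p I)
    have "eval_fps (\<Sum>p\<in>insert p I. fps_const (of_int (c p)) * (fps_X ^ e p * (F ^ fst p * G ^ snd p))) x =
        eval_fps (fps_const (of_int (c p)) * (fps_X ^ e p * (F ^ fst p * G ^ snd p))) x +
        eval_fps (\<Sum>p\<in>I. fps_const (of_int (c p)) * (fps_X ^ e p * (F ^ fst p * G ^ snd p))) x"
      unfolding sum.insert[OF insert.hyps] by (intro add term_digit digit_series_sum)
    then show ?case unfolding sum.insert[OF insert.hyps] insert.IH term_eval .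
  qed auto
qed

lemma lex_max_exists:
  fixes I :: "(nat \<times> nat) set"
  assumes "finite I" "I \<noteq> {}"
  obtains k l where "(k, l) \<in> I" "\<And>i j. (i, j) \<in> I \<Longrightarrow> i < k \<or> i = k \<and> j \<le> l"
proof -
  define k where "k = Max (fst ` I)"
  have "k \<in> fst ` I" unfolding k_def using assms by (intro Max_in) auto
  then obtain l0 where l0: "(k, l0) \<in> I" by auto
  define l where "l = Max {j. (k, j) \<in> I}"
  have sub: "{j. (k, j) \<in> I} \<subseteq> snd ` I" by force
  have fin: "finite {j. (k, j) \<in> I}" by (rule finite_subset[OF sub]) (use assms in simp)
  have "l \<in> {j. (k, j) \<in> I}" unfolding l_def using l0 fin by (intro Max_in) auto
  moreover have "i < k \<or> i = k \<and> j \<le> l" if ij: "(i, j) \<in> I" for i j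
  proof -
    have "i \<in> fst ` I" using ij by force
    then have "i \<le> k" unfolding k_def using assms by (intro Max_ge) auto
    moreover have "j \<le> l" if "i = k" unfolding l_def using ij that fin by (intro Max_ge) auto
    ultimately show ?thesis by linarith
  qed
  ultimately show ?thesis using that by blast
qed

theorem theorem4p2:
  fixes m0 :: nat and a u b v :: "real \<Rightarrow> real" and \<beta> :: real
  assumes a_incr: "ultimately_increasing a"
    and u_incr: "ultimately_increasing u"
    and floor_a_incr: "ultimately_increasing (\<lambda>m::nat. \<lfloor>a (real m)\<rfloor>)"
    and floor_u_incr: "ultimately_increasing (\<lambda>m::nat. \<lfloor>u (real m)\<rfloor>)"
    and b_inverse: "ultimate_inverse (real m0) a b"
    and v_inverse: "ultimate_inverse (real m0) u v"
    and a1_incr: "ultimately_increasing (\<lambda>R::real. ln (a R) / ln R)"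
    and a1_lim: "filterlim (\<lambda>R::real. ln (a R) / ln R) at_top at_top"
    and a2_diff: "a differentiable_on {real m0..}"
    and a2_bound: "\<forall>\<epsilon>>0. \<exists>C10>0. \<forall>R\<ge>C10. deriv (\<lambda>x. ln (a x)) R < R powr (-1 + \<epsilon>)"
    and u1: "\<exists>C11>0. \<forall>\<^sub>F R in at_top. u (R + 1) / u R < C11"
    and u2: "filterlim (\<lambda>R::real. ln (b R) / ln (v R)) at_top at_top"
    and beta: "Pisot \<beta> \<or> Salem \<beta>"
  shows "algebraically_independent
           (\<Sum>m. \<beta> powi (- \<lfloor>a (real (m0 + m))\<rfloor>))
           (\<Sum>m. \<beta> powi (- \<lfloor>u (real (m0 + m))\<rfloor>))"
proof -
  have \<beta>: "algebraic_int \<beta>" "\<beta> > 1"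
    and conj: "\<And>z. rat_conjugate (of_real \<beta>) z \<Longrightarrow> z \<noteq> of_real \<beta> \<Longrightarrow> norm z \<le> 1"
    using beta by (auto simp: Pisot_def Salem_def less_imp_le)
  interpret fast_growth m0 a b
    by unfold_locales (rule b_inverse a1_incr a1_lim a2_diff a2_bound)+
  obtain C11 where C11: "C11 > 0" "\<forall>\<^sub>F R in at_top. u (R + 1) / u R < C11" using u1 by blast
  \<comment> \<open>(u2) puts \<open>ln (v x)\<close> eventually below every positive multiple of
    \<open>ln (b x)\<close>.\<close>
  have v_small: "\<forall>\<^sub>F x in at_top. v x \<le> b x powr \<epsilon>" if \<epsilon>: "\<epsilon> > 0" for \<epsilon>
  proof -
    have "\<forall>\<^sub>F x in at_top. ln (b x) / ln (v x) \<ge> 1 / \<epsilon>" using u2 by (auto simp: filterlim_at_top)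
    moreover have "\<forall>\<^sub>F x in at_top. v x \<ge> 2"
      using ultimate_inverse_at_top(2)[OF v_inverse] by (auto simp: filterlim_at_top)
    ultimately show ?thesis using eventually_b_ge[of 1]
    proof eventually_elim
      case (elim x)
      have "ln (v x) > 0" using elim by simp
      then have "ln (v x) \<le> \<epsilon> * ln (b x)" using elim \<epsilon> by (simp add: field_simps)
      then have "exp (ln (v x)) \<le> exp (\<epsilon> * ln (b x))" by simp
      then show ?case using elim by (simp add: powr_def)
    qed
  qed
  have v_le_powr: "\<forall>\<^sub>F x in at_top. v x \<le> x powr \<epsilon>" if \<epsilon>: "\<epsilon> > 0" for \<epsilon>
  proof -
    have "\<forall>\<^sub>F x in at_top. v x \<le> b x powr 1" by (rule v_small) simp
    then show ?thesis using b_le_powr[OF \<epsilon>] eventually_b_ge[of 1] by eventually_elim auto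
  qed
  obtain K \<alpha> F where \<alpha>: "\<And>m. int (\<alpha> m) = \<lfloor>a (real (m0 + m))\<rfloor> - K"
    and F: "digit_series F" "nonneg_fps F" "fps_supp F = range \<alpha>" "0 \<in> fps_supp F"
    and \<xi>: "(\<Sum>m. \<beta> powi (- \<lfloor>a (real (m0 + m))\<rfloor>)) = \<beta> powi (- K) * eval_fps F (1 / \<beta>)"
    by (rule floor_series[OF floor_a_incr \<beta>(2), of m0]) (rule that)
  obtain L \<mu> G where \<mu>: "\<And>m. int (\<mu> m) = \<lfloor>u (real (m0 + m))\<rfloor> - L"
    and G: "digit_series G" "nonneg_fps G" "fps_supp G = range \<mu>" "0 \<in> fps_supp G"
    and \<eta>: "(\<Sum>m. \<beta> powi (- \<lfloor>u (real (m0 + m))\<rfloor>)) = \<beta> powi (- L) * eval_fps G (1 / \<beta>)"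
    by (rule floor_series[OF floor_u_incr \<beta>(2), of m0]) (rule that)
  let ?\<xi> = "\<Sum>m. \<beta> powi (- \<lfloor>a (real (m0 + m))\<rfloor>)" and ?\<eta> = "\<Sum>m. \<beta> powi (- \<lfloor>u (real (m0 + m))\<rfloor>)"
  let ?F = "eval_fps F (1 / \<beta>)" and ?G = "eval_fps G (1 / \<beta>)"
  have cardF: "\<forall>\<^sub>F N in sequentially. real (card (fps_supp F \<inter> {..<N})) \<le> b (real N + of_int K) + 1"
    unfolding F(3) by (rule card_exponents_le[OF b_inverse \<alpha>])
  have cardG: "\<forall>\<^sub>F N in sequentially. real (card (fps_supp G \<inter> {..<N})) \<le> v (real N + of_int L) + 1"
    unfolding G(3) by (rule card_exponents_le[OF v_inverse \<mu>])
  have sparse: "\<forall>\<^sub>F q in sequentially. card (fps_supp (F ^ i * G ^ j) \<inter> {..<3 * q ^ 16}) \<le> q" for i j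
    by (intro card_supp_bipower_le eventually_le_powr_exponent_bound[OF b_le_powr cardF]
          eventually_le_powr_exponent_bound[OF v_le_powr cardG])
  have dense: "\<forall>\<^sub>F q in sequentially. \<exists>x\<in>fps_supp G. q ^ 3 \<le> x \<and> x \<le> q ^ 8"
    unfolding G(3) by (rule slow_exponent_window[OF v_inverse C11(2,1) \<mu>])
  \<comment> \<open>For \<open>N = q ^ 16\<close> the distance \<open>N powr (3/4)\<close> is
    \<open>q ^ 12\<close>.\<close>
  have isol: "\<forall>\<^sub>F q in sequentially. \<exists>s\<in>fps_supp (F ^ k). s \<le> q ^ 16 \<and>
        (\<forall>t\<in>fps_supp (F ^ (k - 1) * G ^ J). t + q ^ 12 < s \<or> s + q ^ 12 < t)" if k: "k > 0" for k J
  proof -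
    have lim: "filterlim (\<lambda>q::nat. q ^ 16) sequentially sequentially"
    proof (rule filterlim_at_top_mono[OF filterlim_ident])
      show "\<forall>\<^sub>F q in sequentially. q \<le> q ^ 16"
        using eventually_ge_at_top[of 1] by eventually_elim (intro self_le_power, simp_all)
    qed
    have "\<forall>\<^sub>F N in sequentially. \<exists>s\<in>fps_supp (F ^ k). s \<le> N \<and>
      (\<forall>t\<in>fps_supp (F ^ (k - 1) * G ^ J). real t + real N powr (3/4) < real s \<or> real s + real N powr (3/4) < real t)"
      by (rule isolated_power_sum[OF \<alpha> F(2,4,3) cardG _ k]) (rule v_small)
    then have "\<forall>\<^sub>F q in sequentially. \<exists>s\<in>fps_supp (F ^ k). s \<le> q ^ 16 \<and>
      (\<forall>t\<in>fps_supp (F ^ (k - 1) * G ^ J). real t + real (q ^ 16) powr (3/4) < real s \<or> real s + real (q ^ 16) powr (3/4) < real t)"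
      using lim by (rule eventually_compose_filterlim)
    then show ?thesis using eventually_ge_at_top[of 1]
    proof eventually_elim
      case (elim q)
      have "real (q ^ 16) powr (3/4) = real (q ^ 12)"
      proof -
        have "real (q ^ 16) = real q powr 16" using elim(2) powr_realpow[of "real q" 16] by simp
        then have "real (q ^ 16) powr (3/4) = real q powr 12" by (simp only: powr_powr) simp
        then show ?thesis using elim(2) powr_realpow[of "real q" 12] by simp
      qed
      with elim(1) have "\<exists>s\<in>fps_supp (F ^ k). s \<le> q ^ 16 \<and>
        (\<forall>t\<in>fps_supp (F ^ (k - 1) * G ^ J). real (t + q ^ 12) < real s \<or> real (s + q ^ 12) < real t)" by simp
      then show ?case unfolding of_nat_less_iff .
    qed
  qed
  show ?thesis unfolding algebraically_independent_def
  proof (intro allI impI notI)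
    fix P :: "rat poly poly" assume "P \<noteq> 0" and "eval2 P ?\<xi> ?\<eta> = 0"
    then obtain I and c :: "nat \<times> nat \<Rightarrow> int" where I: "finite I" "I \<noteq> {}" and c0: "\<And>p. p \<in> I \<Longrightarrow> c p \<noteq> 0"
      and zero: "(\<Sum>p\<in>I. of_int (c p) * (?\<xi> ^ fst p * ?\<eta> ^ snd p)) = 0"
      by (rule eval2_zero_int_relation) (rule that)
    obtain k l where kl: "(k, l) \<in> I" "\<And>i j. (i, j) \<in> I \<Longrightarrow> i < k \<or> i = k \<and> j \<le> l"
      using lex_max_exists[OF I] by blast
    \<comment> \<open>The sign makes the leading coefficient positive.\<close>
    define c' where "c' = (\<lambda>p. sgn (c (k, l)) * c p)"
    have c'pos: "c' (k, l) > 0" using c0[OF kl(1)] by (auto simp: c'_def sgn_if)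
    \<comment> \<open>A monomial in the two numbers is \<open>\<beta> powi (- Z p)\<close> times the
      same monomial in \<open>?F\<close> and \<open>?G\<close>. Multiplying the relation by
      \<open>\<beta> powi (- Z0)\<close> leaves only nonnegative powers \<open>e p\<close> of
      \<open>1 / \<beta>\<close>.\<close>
    define Z where "Z = (\<lambda>p. K * int (fst p) + L * int (snd p))"
    define Z0 where "Z0 = Max ((\<lambda>p. \<bar>Z p\<bar>) ` I)"
    define e where "e = (\<lambda>p. nat (Z0 + Z p))"
    have e: "int (e p) = Z0 + Z p" if "p \<in> I" for p
    proof -
      have "\<bar>Z p\<bar> \<le> Z0" unfolding Z0_def using I that by (intro Max_ge) auto
      then show ?thesis by (simp add: e_def)
    qed
    have powers: "(1 / \<beta>) ^ e p * (?F ^ fst p * ?G ^ snd p) = \<beta> powi (- Z0) * (?\<xi> ^ fst p * ?\<eta> ^ snd p)"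
      if "p \<in> I" for p
    proof -
      have "(1 / \<beta>) ^ e p = \<beta> powi (- int (e p))"
        by (simp add: power_int_minus power_one_over inverse_eq_divide)
      also have "- int (e p) = - Z0 + ((- K) * int (fst p) + (- L) * int (snd p))"
        using e[OF that] by (simp add: Z_def)
      also have "\<beta> powi \<dots> = \<beta> powi (- Z0) * ((\<beta> powi (- K)) ^ fst p * (\<beta> powi (- L)) ^ snd p)"
        using \<beta>(2) by (subst power_int_add, simp, subst power_int_add, simp)
          (simp only: power_int_mult power_int_of_nat)
      finally show ?thesis unfolding \<xi> \<eta> by (simp add: power_mult_distrib mult_ac)
    qed
    define H where "H = fps_bipoly I c' e F G"
    have dH: "digit_series H" unfolding H_def by (rule digit_series_bipoly[OF F(1) G(1)])
    have "eval_fps H (1 / \<beta>) = (\<Sum>p\<in>I. of_int (c' p) * ((1 / \<beta>) ^ e p * (?F ^ fst p * ?G ^ snd p)))"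
      unfolding H_def by (rule eval_fps_bipoly[OF F(1) G(1)]) (use \<beta> in auto)
    also have "\<dots> = (\<Sum>p\<in>I. (of_int (sgn (c (k, l))) * \<beta> powi (- Z0)) * (of_int (c p) * (?\<xi> ^ fst p * ?\<eta> ^ snd p)))"
      by (intro sum.cong refl) (simp only: powers c'_def of_int_mult mult_ac)
    also have "\<dots> = 0" unfolding sum_distrib_left[symmetric] zero by simp
    finally have H0: "eval_fps H (1 / \<beta>) = 0" .
    define h where "h = (\<lambda>n. \<lfloor>fps_nth H n\<rfloor>)"
    have h: "real_of_int (h n) = fps_nth H n" for n
      using dH by (auto simp: h_def digit_series_def elim: Ints_cases)
    obtain C E where CE: "C \<ge> 0" "\<And>n. \<bar>fps_nth H n\<bar> \<le> C * real (n + 1) ^ E"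
      using dH by (rule digit_seriesE) (rule that)
    have hC: "\<And>n. \<bar>real_of_int (h n)\<bar> \<le> C * real (n + 1) ^ E" using CE(2) by (simp only: h)
    have hs: "(\<lambda>n. h n * (1 / \<beta>) ^ n) sums 0"
      unfolding h H0[symmetric]
      by (intro sums_eval_fps digit_series_conv_radius[OF dH]) (use \<beta> in auto)
    obtain B N0 where B: "B > 0" and no: "\<forall>N\<ge>N0. \<forall>z\<le>N. \<forall>W\<le>N. B * ln (real N) \<le> real W \<longrightarrow>
      \<not> (h z > 0 \<and> (\<forall>n<z. z \<le> n + W \<longrightarrow> h n = 0) \<and> (\<forall>n. z < n \<longrightarrow> n \<le> z + W \<longrightarrow> h n \<ge> 0))"
    proof (rule no_isolated_positive_digit[OF \<beta> _ hC hs])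
      show "norm z \<le> 1" if "rat_conjugate (of_real \<beta>) z" "z \<noteq> of_real \<beta>" for z
        by (rule conj[OF that])
    qed (rule that)
    have "\<forall>\<^sub>F q in sequentially. \<exists>z \<le> 3 * q ^ 16. fps_nth H z > 0 \<and>
     (\<forall>n<z. z \<le> n + q \<longrightarrow> fps_nth H n = 0) \<and> (\<forall>n. z < n \<longrightarrow> n \<le> z + q \<longrightarrow> fps_nth H n \<ge> 0)"
      unfolding H_def
    proof (rule isolated_top_digit[where I = I and c = c' and k = k and l = l, OF F(2) G(2) F(4) G(4) I(1) kl(1) c'pos])
      show "i < k \<or> i = k \<and> j \<le> l" if "(i, j) \<in> I" for i j by (rule kl(2)[OF that])
    qed (rule sparse isol dense | assumption)+
    \<comment> \<open>The digit lemma is applied with \<open>N = 3 * q ^ 16\<close> and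
      \<open>W = q\<close>, a window that outgrows \<open>B * ln N\<close>.\<close>
    moreover have "\<forall>\<^sub>F q in sequentially. B * ln (real (3 * q ^ 16)) \<le> real q" by real_asymp
    ultimately have "\<forall>\<^sub>F q::nat in sequentially. False" using eventually_ge_at_top[of "N0 + 1"]
    proof eventually_elim
      case (elim q)
      obtain z where z: "z \<le> 3 * q ^ 16" "fps_nth H z > 0"
        "\<And>n. n < z \<Longrightarrow> z \<le> n + q \<Longrightarrow> fps_nth H n = 0" "\<And>n. z < n \<Longrightarrow> n \<le> z + q \<Longrightarrow> fps_nth H n \<ge> 0"
        using elim(1) by blast
      have "q \<le> q ^ 16" using elim(3) by (intro self_le_power) auto
      then have q: "q \<le> 3 * q ^ 16" "N0 \<le> 3 * q ^ 16" using elim(3) by linarith+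
      have "h z > 0" using z(2) h[of z] by linarith
      moreover have "h n = 0" if "n < z" "z \<le> n + q" for n using z(3)[OF that] h[of n] by simp
      moreover have "h n \<ge> 0" if "z < n" "n \<le> z + q" for n using z(4)[OF that] h[of n] by linarith
      ultimately show False using no q z(1) elim(2) by blast
    qed
    then show False by simp
  qed
qed

end
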